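(* Let $k$ be any field. Let $G$ be a subgroup of the symmetric group $S_n$ acting on the rational function field $k(x_1,\ldots,x_n)$ in $n$ variables via $k$-automorphisms defined by $\sigma\cdot x_i = x_{\sigma(i)}$ for any $\sigma\in G$ and any $1\le i\le n$. If $n\le 4$, then the fixed field $k(x_1,\ldots,x_n)^G$ is $k$-rational.
   Context: A finitely generated field extension $L$ of a field $k$ is called $k$-rational if $L$ is purely transcendental over $k$. For a group $G$ acting on a field $F$ by automorphisms, $F^G=\{f\in F : \sigma(f)=f \text{ for all } \sigma\in G\}$. *)

theory Defs
  imports
    "HOL-Library.Poly_Mapping"
    "HOL-Computational_Algebra.Fraction_Field"
    "HOL-Algebra.Sym_Groups"
    "HOL-Algebra.Generated_Fields"
    "HOL-Algebra.Algebraic_Closure_Type"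
begin

section \<open>Purely transcendental and rational field extensions\<close>

text \<open>Subfields of an ambient field type are sets \<open>K\<close>, \<open>L\<close>;
  \<open>adjoin K S\<close> is the subfield \<open>K(S)\<close>.\<close>

definition adjoin :: "'a::field set \<Rightarrow> 'a set \<Rightarrow> 'a set" where
  "adjoin K S = generate_field ring_of_type_algebra (K \<union> S)"

text \<open>A polynomial in variables indexed by \<open>'i\<close> is a finitely supported function from
  monomials, which are themselves finitely supported exponent vectors, to coefficients.\<close>

type_synonym ('i, 'a) mpoly = "('i \<Rightarrow>\<^sub>0 nat) \<Rightarrow>\<^sub>0 'a"

definition mpoly_eval :: "('i \<Rightarrow> 'a::comm_ring_1) \<Rightarrow> ('i, 'a) mpoly \<Rightarrow> 'a" where
  "mpoly_eval x P = (\<Sum>m\<in>Poly_Mapping.keys P.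
     Poly_Mapping.lookup P m * (\<Prod>i\<in>Poly_Mapping.keys m. x i ^ Poly_Mapping.lookup m i))"

text \<open>The elements of \<open>B\<close> index the variables, and the variable with index \<open>b\<close> is
  evaluated at \<open>b\<close> itself.\<close>

definition algebraically_independent :: "'a::field set \<Rightarrow> 'a set \<Rightarrow> bool" where
  "algebraically_independent K B \<longleftrightarrow>
     (\<forall>P :: ('a, 'a) mpoly.
        (\<forall>m. Poly_Mapping.lookup P m \<in> K) \<and> (\<forall>m\<in>Poly_Mapping.keys P. Poly_Mapping.keys m \<subseteq> B) \<and>
        mpoly_eval (\<lambda>b. b) P = 0 \<longrightarrow> P = 0)"

definition finitely_generated_over :: "'a::field set \<Rightarrow> 'a set \<Rightarrow> bool" where
  "finitely_generated_over K L \<longleftrightarrow> (\<exists>A. finite A \<and> L = adjoin K A)"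

definition purely_transcendental_over :: "'a::field set \<Rightarrow> 'a set \<Rightarrow> bool" where
  "purely_transcendental_over K L \<longleftrightarrow> (\<exists>B. algebraically_independent K B \<and> L = adjoin K B)"

definition rational_over :: "'a::field set \<Rightarrow> 'a set \<Rightarrow> bool" where
  "rational_over K L \<longleftrightarrow> finitely_generated_over K L \<and> purely_transcendental_over K L"


section \<open>Rational function fields\<close>

text \<open>All the fields \<open>k(x\<^sub>1, \<dots>, x\<^sub>n)\<close> live inside the field of rational
  functions in countably many variables \<open>x\<^sub>0, x\<^sub>1, x\<^sub>2, \<dots>\<close> as the subfields
  generated by the constants and \<open>x\<^sub>1, \<dots>, x\<^sub>n\<close>.\<close>

type_synonym 'k ratfun = "(nat, 'k) mpoly fract"

definition ratfun_const :: "'k::field \<Rightarrow> 'k ratfun" where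
  "ratfun_const c = Fract (Poly_Mapping.single 0 c) 1"

definition ratfun_var :: "nat \<Rightarrow> 'k::field ratfun" where
  "ratfun_var i = Fract (Poly_Mapping.single (Poly_Mapping.single i 1) 1) 1"

definition ratfun_field :: "nat \<Rightarrow> 'k::field ratfun set" where
  "ratfun_field n = adjoin (range ratfun_const) (ratfun_var ` {1..n})"


section \<open>The permutation action on the variables\<close>

text \<open>\<open>map_key s m\<close> has exponent \<open>m (s i)\<close> at \<open>i\<close>.  Hence the coefficient of
  \<open>mpoly_permute s p\<close> at the monomial with exponent \<open>e i\<close> at \<open>s i\<close> is the
  coefficient of \<open>p\<close> at the monomial with exponent \<open>e i\<close> at \<open>i\<close>: the variable
  \<open>i\<close> is replaced by the variable \<open>s i\<close>.\<close>

definition mpoly_permute :: "('i \<Rightarrow> 'i) \<Rightarrow> ('i, 'a::zero) mpoly \<Rightarrow> ('i, 'a) mpoly" where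
  "mpoly_permute s p = Poly_Mapping.map_key (Poly_Mapping.map_key s) p"

lemma inj_map_key_bij:
  assumes "bij s"
  shows "inj (Poly_Mapping.map_key s :: ('i \<Rightarrow>\<^sub>0 nat) \<Rightarrow> ('i \<Rightarrow>\<^sub>0 nat))"
proof (rule injI)
  fix m m' :: "'i \<Rightarrow>\<^sub>0 nat"
  assume eq: "Poly_Mapping.map_key s m = Poly_Mapping.map_key s m'"
  show "m = m'"
  proof (rule poly_mapping_eqI)
    fix j
    obtain i where "j = s i" using assms by (metis bij_pointE)
    then show "Poly_Mapping.lookup m j = Poly_Mapping.lookup m' j"
      using arg_cong[OF eq, of "\<lambda>m. Poly_Mapping.lookup m i"] bij_is_inj[OF assms]
      by (simp add: map_key.rep_eq)
  qed
qed

lemma lookup_mpoly_permute: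
  assumes "bij s"
  shows "Poly_Mapping.lookup (mpoly_permute s p) m =
           Poly_Mapping.lookup p (Poly_Mapping.map_key s m)"
  using inj_map_key_bij[OF assms] by (simp add: mpoly_permute_def map_key.rep_eq)

lemma mpoly_permute_zero: "bij s \<Longrightarrow> mpoly_permute s 0 = 0"
  by (rule poly_mapping_eqI) (simp add: lookup_mpoly_permute)

lemma mpoly_permute_add:
  "bij s \<Longrightarrow> mpoly_permute s (p + q) = mpoly_permute s p + mpoly_permute s q"
  by (rule poly_mapping_eqI) (simp add: lookup_mpoly_permute lookup_add)

lemma mpoly_permute_eq_0_iff:
  fixes p :: "('i, 'a::zero) mpoly"
  assumes "bij s"
  shows "mpoly_permute s p = 0 \<longleftrightarrow> p = 0"
proof
  assume *: "mpoly_permute s p = 0"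
  show "p = 0"
  proof (rule poly_mapping_eqI)
    fix m :: "'i \<Rightarrow>\<^sub>0 nat"
    have "m = Poly_Mapping.map_key s (Poly_Mapping.map_key (inv_into UNIV s) m)"
      using assms bij_is_inj[OF assms] bij_imp_bij_inv[OF assms]
      by (subst map_key_compose) (auto simp: bij_is_inj map_key_id o_def)
    then show "Poly_Mapping.lookup p m = Poly_Mapping.lookup 0 m"
      using lookup_mpoly_permute[OF assms] * by (metis lookup_zero)
  qed
qed (simp add: assms mpoly_permute_zero)

lemma mpoly_permute_single:
  assumes "bij s"
  shows "mpoly_permute s (Poly_Mapping.single (Poly_Mapping.map_key s m) c) = Poly_Mapping.single m c"
  using inj_map_key_bij[OF assms] by (simp add: mpoly_permute_def)

lemma mpoly_induct [case_names zero add_single]: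
  assumes "P 0" and "\<And>p m c. P p \<Longrightarrow> P (Poly_Mapping.single m c + p)"
  shows "P (p :: ('i, 'a::comm_ring_1) mpoly)"
proof (induction p rule: update_induct)
  case const
  show ?case by (fact assms(1))
next
  case (update p m c)
  have "Poly_Mapping.update m c p = Poly_Mapping.single m c + p"
    by (rule poly_mapping_eqI)
      (use update in \<open>auto simp: lookup_update lookup_add lookup_single when_def in_keys_iff\<close>)
  then show ?case using assms(2) update by simp
qed

lemma mpoly_permute_mult:
  fixes p q :: "('i, 'a::comm_ring_1) mpoly"
  assumes "bij s"
  shows "mpoly_permute s (p * q) = mpoly_permute s p * mpoly_permute s q"
proof -
  have surj: "\<exists>m'. m = Poly_Mapping.map_key s m'" for m :: "'i \<Rightarrow>\<^sub>0 nat"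
  proof
    show "m = Poly_Mapping.map_key s (Poly_Mapping.map_key (inv_into UNIV s) m)"
      using assms bij_is_inj[OF assms] bij_imp_bij_inv[OF assms]
      by (subst map_key_compose) (auto simp: bij_is_inj map_key_id o_def)
  qed
  have single: "mpoly_permute s (Poly_Mapping.single m c * Poly_Mapping.single m' d) =
      mpoly_permute s (Poly_Mapping.single m c) * mpoly_permute s (Poly_Mapping.single m' d)"
    for m m' :: "'i \<Rightarrow>\<^sub>0 nat" and c d :: 'a
  proof -
    obtain a b where ab: "m = Poly_Mapping.map_key s a" "m' = Poly_Mapping.map_key s b"
      using surj by metis
    have "m + m' = Poly_Mapping.map_key s (a + b)"
      using map_key_plus[OF bij_is_inj[OF assms]] ab by metis
    then show ?thesis
      using ab by (simp add: mult_single mpoly_permute_single[OF assms])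
  qed
  have left: "mpoly_permute s (Poly_Mapping.single m c * q) =
      mpoly_permute s (Poly_Mapping.single m c) * mpoly_permute s q" for m c
    by (induction q rule: mpoly_induct)
      (simp_all add: single mpoly_permute_zero[OF assms] mpoly_permute_add[OF assms] distrib_left)
  show ?thesis
    by (induction p rule: mpoly_induct)
      (simp_all add: left mpoly_permute_zero[OF assms] mpoly_permute_add[OF assms] distrib_right)
qed

text \<open>The map of fraction fields induced by an injective ring homomorphism \<open>h\<close>;
  \<open>THE\<close> expresses independence of the representation as a fraction.\<close>

definition fract_map :: "('a::idom \<Rightarrow> 'b::idom) \<Rightarrow> 'a fract \<Rightarrow> 'b fract" where
  "fract_map h f = (THE g. \<exists>p q. q \<noteq> 0 \<and> f = Fract p q \<and> g = Fract (h p) (h q))"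

lemma fract_map_Fract:
  assumes h0: "\<And>x. h x = 0 \<longleftrightarrow> x = 0" and mult: "\<And>x y. h (x * y) = h x * h y"
    and q: "q \<noteq> 0"
  shows "fract_map h (Fract p q) = Fract (h p) (h q)"
  unfolding fract_map_def
proof (rule the_equality)
  show "\<exists>p' q'. q' \<noteq> 0 \<and> Fract p q = Fract p' q' \<and> Fract (h p) (h q) = Fract (h p') (h q')"
    using q by blast
next
  fix g
  assume "\<exists>p' q'. q' \<noteq> 0 \<and> Fract p q = Fract p' q' \<and> g = Fract (h p') (h q')"
  then obtain p' q' where *: "q' \<noteq> 0" "p * q' = p' * q" "g = Fract (h p') (h q')"
    using q by (auto simp: eq_fract)
  then have "h p * h q' = h p' * h q" by (metis mult)
  then show "g = Fract (h p) (h q)" using * q h0 by (simp add: eq_fract)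
qed

text \<open>For \<open>s\<close> bijective, the facts below identify \<open>ratfun_permute s\<close> as the field
  automorphism that fixes the constants and sends \<open>x\<^sub>i\<close> to \<open>x\<^bsub>s i\<^esub>\<close>.\<close>

definition ratfun_permute :: "(nat \<Rightarrow> nat) \<Rightarrow> 'k::field ratfun \<Rightarrow> 'k ratfun" where
  "ratfun_permute s = fract_map (mpoly_permute s)"

lemma mpoly_permute_const:
  assumes "bij s"
  shows "mpoly_permute s (Poly_Mapping.single 0 c) = Poly_Mapping.single 0 c"
  using mpoly_permute_single[OF assms, of 0 c] bij_is_inj[OF assms] by simp

lemma mpoly_permute_one:
  "bij s \<Longrightarrow> mpoly_permute s (1 :: ('i, 'a::comm_ring_1) mpoly) = 1"
  by (simp add: mpoly_permute_const flip: single_one)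

lemma ratfun_permute_Fract:
  assumes "bij s" "q \<noteq> 0"
  shows "ratfun_permute s (Fract p q) = Fract (mpoly_permute s p) (mpoly_permute s q)"
  unfolding ratfun_permute_def
  using assms by (intro fract_map_Fract)
    (simp_all add: mpoly_permute_eq_0_iff mpoly_permute_mult)

lemma ratfun_permute_const:
  assumes "bij s"
  shows "ratfun_permute s (ratfun_const c) = ratfun_const c"
  using assms by (simp add: ratfun_const_def ratfun_permute_Fract mpoly_permute_const mpoly_permute_one)

lemma ratfun_permute_var:
  assumes "bij s"
  shows "ratfun_permute s (ratfun_var i :: 'k::field ratfun) = ratfun_var (s i)"
proof -
  have "Poly_Mapping.map_key s (Poly_Mapping.single (s i) (1::nat)) = Poly_Mapping.single i 1"
    using bij_is_inj[OF assms] by simp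
  then show ?thesis
    using assms mpoly_permute_single[OF assms, of "Poly_Mapping.single (s i) 1" "1::'k"]
    by (simp add: ratfun_var_def ratfun_permute_Fract mpoly_permute_one)
qed

lemma ratfun_permute_add:
  assumes "bij s"
  shows "ratfun_permute s (f + g) = ratfun_permute s f + ratfun_permute s g"
  using assms
  by (cases f; cases g)
    (simp add: ratfun_permute_Fract mpoly_permute_eq_0_iff mpoly_permute_add mpoly_permute_mult)

lemma ratfun_permute_mult:
  assumes "bij s"
  shows "ratfun_permute s (f * g) = ratfun_permute s f * ratfun_permute s g"
  using assms by (cases f; cases g) (simp add: ratfun_permute_Fract mpoly_permute_mult)

lemma ratfun_permute_one: "bij s \<Longrightarrow> ratfun_permute s 1 = 1"
  by (simp add: One_fract_def ratfun_permute_Fract mpoly_permute_one)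

lemma ratfun_permute_comp:
  assumes "bij s" "bij t"
  shows "ratfun_permute s (ratfun_permute t f) = ratfun_permute (s \<circ> t) f"
proof -
  have "mpoly_permute s (mpoly_permute t p) = mpoly_permute (s \<circ> t) p" for p :: "(nat, 'a) mpoly"
    using assms
    by (intro poly_mapping_eqI)
      (simp add: lookup_mpoly_permute bij_comp map_key_compose bij_is_inj)
  then show ?thesis
    using assms by (cases f) (simp add: ratfun_permute_Fract mpoly_permute_eq_0_iff bij_comp)
qed

definition ratfun_fixed_field :: "nat \<Rightarrow> (nat \<Rightarrow> nat) set \<Rightarrow> 'k::field ratfun set" where
  "ratfun_fixed_field n G = {f \<in> ratfun_field n. \<forall>s\<in>G. ratfun_permute s f = f}"

end

theory Submission imports Defs begin

text \<open>For each subgroup \<open>G\<close> of \<open>S\<^sub>4\<close> up to relabelling there is an explicit set \<open>B\<close> of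
  \<open>n\<close> invariants.  That \<open>B\<close> generates the fixed field is shown by climbing from \<open>k(B)\<close> to
  \<open>k(x\<^sub>1, \<dots>, x\<^sub>n)\<close> one element at a time: if \<open>\<theta>\<close> is a root of a polynomial of degree \<open>d\<close>
  over \<open>K\<close> and has \<open>d\<close> distinct images under elements of \<open>G\<close> fixing \<open>K\<close>, then an invariant
  \<open>f = p(\<theta>) / q(\<theta>)\<close> with \<open>p\<close>, \<open>q\<close> of degree less than \<open>d\<close> makes \<open>f q - p\<close> vanish at \<open>d\<close>
  points, so \<open>f \<in> K\<close>.  As the \<open>n\<close> variables are then algebraic over \<open>k(B)\<close>, Steinitz exchange
  makes \<open>B\<close> algebraically independent.\<close>

section \<open>Subfields and adjunction\<close>

text \<open>The arbitrary characteristic governs the choice of invariants. Averaging over the group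
  fails when 2 or 3 vanishes, and diagonalising a generator needs roots of unity that
  \<open>k\<close> may lack. The symmetric, Klein, dihedral and three-element cyclic groups admit
  formulas valid in every characteristic; the cyclic group of order four and the alternating group
  are split according to whether 2 is zero. The base field is kept arbitrary throughout, so that an
  invariant once found, or a variable that \<open>G\<close> never moves, can be counted among the
  constants. Larger groups are then treated by towers: the invariants of a normal subgroup first,
  then the action of the quotient on them. For the alternating group the independence of a
  generating set is used inside the construction as well: the invariants of its Klein subgroup are
  independent and so can stand in for variables when the quotient of order three acts.\<close>

definition is_subfield :: "'a::field set \<Rightarrow> bool" where
  "is_subfield K \<longleftrightarrow> 0 \<in> K \<and> 1 \<in> K \<and> (\<forall>x\<in>K. \<forall>y\<in>K. x + y \<in> K \<and> x * y \<in> K) \<and>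
     (\<forall>x\<in>K. - x \<in> K \<and> inverse x \<in> K)"

lemma is_subfieldD:
  assumes "is_subfield K"
  shows "0 \<in> K" "1 \<in> K"
    "x \<in> K \<Longrightarrow> y \<in> K \<Longrightarrow> x + y \<in> K" "x \<in> K \<Longrightarrow> y \<in> K \<Longrightarrow> x * y \<in> K"
    "x \<in> K \<Longrightarrow> - x \<in> K" "x \<in> K \<Longrightarrow> inverse x \<in> K"
    "x \<in> K \<Longrightarrow> y \<in> K \<Longrightarrow> x - y \<in> K" "x \<in> K \<Longrightarrow> y \<in> K \<Longrightarrow> x / y \<in> K"
    "x \<in> K \<Longrightarrow> x ^ m \<in> K" "numeral w \<in> K" "of_nat m \<in> K"
proof -
  show *: "0 \<in> K" "1 \<in> K" "x \<in> K \<Longrightarrow> y \<in> K \<Longrightarrow> x + y \<in> K" "x \<in> K \<Longrightarrow> y \<in> K \<Longrightarrow> x * y \<in> K"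
    "x \<in> K \<Longrightarrow> - x \<in> K" "x \<in> K \<Longrightarrow> inverse x \<in> K" for x y
    using assms by (auto simp: is_subfield_def)
  show "x \<in> K \<Longrightarrow> y \<in> K \<Longrightarrow> x - y \<in> K"
    using *(3)[of x "- y"] *(5) by simp
  show "x \<in> K \<Longrightarrow> y \<in> K \<Longrightarrow> x / y \<in> K"
    by (simp add: divide_inverse *)
  show "x \<in> K \<Longrightarrow> x ^ m \<in> K"
    by (induction m) (simp_all add: *)
  show of_nat: "of_nat m \<in> K" for m
    by (induction m) (simp_all add: *)
  show "numeral w \<in> K"
    using of_nat[of "numeral w"] by simp
qed

lemma is_subfield_sum: "is_subfield K \<Longrightarrow> (\<And>i. i \<in> I \<Longrightarrow> f i \<in> K) \<Longrightarrow> sum f I \<in> K"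
  by (induction I rule: infinite_finite_induct) (auto simp: is_subfieldD)

lemma is_subfield_prod: "is_subfield K \<Longrightarrow> (\<And>i. i \<in> I \<Longrightarrow> f i \<in> K) \<Longrightarrow> prod f I \<in> K"
  by (induction I rule: infinite_finite_induct) (auto simp: is_subfieldD)

lemma ring_of_type_algebra_simps:
  "carrier (ring_of_type_algebra :: 'a::field ring) = UNIV"
  "mult (ring_of_type_algebra :: 'a ring) = (*)"
  "one (ring_of_type_algebra :: 'a ring) = 1"
  "ring.zero (ring_of_type_algebra :: 'a ring) = 0"
  "add (ring_of_type_algebra :: 'a ring) = (+)"
  by (simp_all add: ring_of_type_algebra_def)

lemma a_inv_ring_of_type_algebra: "a_inv ring_of_type_algebra (x :: 'a::field) = - x"
proof -
  interpret R: field "ring_of_type_algebra :: 'a ring"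
    by (rule field_from_type_algebra)
  show ?thesis
    using R.minus_equality[of "- x" x] by (simp add: ring_of_type_algebra_simps)
qed

lemma m_inv_ring_of_type_algebra:
  assumes "(x :: 'a::field) \<noteq> 0"
  shows "m_inv ring_of_type_algebra x = inverse x"
proof -
  interpret R: field "ring_of_type_algebra :: 'a ring"
    by (rule field_from_type_algebra)
  show ?thesis
    using R.inv_char[of x "inverse x"] assms by (simp add: ring_of_type_algebra_simps)
qed

text \<open>Bridge to HOL-Algebra, whose finite extensions and dimensions yield transitivity of
  algebraicity. As \<open>inverse 0 = 0\<close>, closure under \<open>inverse\<close> carries no
  side condition on the left.\<close>

lemma is_subfield_iff_subfield: "is_subfield K \<longleftrightarrow> subfield K ring_of_type_algebra"
proof -
  interpret R: field "ring_of_type_algebra :: 'a ring"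
    by (rule field_from_type_algebra)
  note simps = ring_of_type_algebra_simps a_inv_ring_of_type_algebra m_inv_ring_of_type_algebra
  show ?thesis
  proof
    assume K: "is_subfield K"
    show "subfield K ring_of_type_algebra"
      by (rule R.subfieldI', rule R.subringI) (use K in \<open>auto simp: simps is_subfieldD\<close>)
  next
    assume K: "subfield K ring_of_type_algebra"
    have "inverse x \<in> K" if "x \<in> K" for x
      using R.subfield_m_inv(1)[OF K, of x] that subringE(2)[OF subfieldE(1)[OF K]]
      by (cases "x = 0") (auto simp: simps)
    then show "is_subfield K"
      using subringE[OF subfieldE(1)[OF K]] by (auto simp: is_subfield_def simps)
  qed
qed

lemma is_subfield_adjoin: "is_subfield (adjoin K S)"
proof -
  interpret R: field "ring_of_type_algebra :: 'a ring"
    by (rule field_from_type_algebra)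
  show ?thesis
    unfolding is_subfield_iff_subfield adjoin_def
    by (rule R.generate_field_is_subfield) (simp add: ring_of_type_algebra_simps)
qed

lemmas adjoin_closed = is_subfieldD[OF is_subfield_adjoin]

lemma adjoin_base: "K \<subseteq> adjoin K S" and adjoin_gens: "S \<subseteq> adjoin K S"
  by (auto simp: adjoin_def intro: generate_field.incl)

lemma adjoin_baseI: "x \<in> K \<Longrightarrow> x \<in> adjoin K S" and adjoin_genI: "x \<in> S \<Longrightarrow> x \<in> adjoin K S"
  using adjoin_base adjoin_gens by blast+

lemma adjoin_least:
  assumes "is_subfield L" "K \<subseteq> L" "S \<subseteq> L"
  shows "adjoin K S \<subseteq> L"
proof -
  interpret R: field "ring_of_type_algebra :: 'a ring"
    by (rule field_from_type_algebra)
  show ?thesis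
    unfolding adjoin_def
    by (rule R.generate_field_min_subfield1)
      (use assms in \<open>auto simp: ring_of_type_algebra_simps is_subfield_iff_subfield\<close>)
qed

lemma adjoin_mono: "K \<subseteq> K' \<Longrightarrow> S \<subseteq> S' \<Longrightarrow> adjoin K S \<subseteq> adjoin K' S'"
  by (intro adjoin_least is_subfield_adjoin) (auto intro: adjoin_baseI adjoin_genI)

lemma adjoin_adjoin: "adjoin (adjoin K S) T = adjoin K (S \<union> T)"
  by (intro equalityI adjoin_least is_subfield_adjoin adjoin_mono)
    (auto intro: adjoin_baseI adjoin_genI)

lemma adjoin_eqI:
  assumes "S \<subseteq> adjoin K T" "T \<subseteq> adjoin K S"
  shows "adjoin K S = adjoin K T"
  using assms by (intro equalityI adjoin_least is_subfield_adjoin adjoin_base)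

lemma adjoin_absorb: "T \<subseteq> adjoin K S \<Longrightarrow> adjoin K (S \<union> T) = adjoin K S"
  by (intro adjoin_eqI) (auto intro: adjoin_genI)

text \<open>Injectivity is automatic, so these are the embeddings of the field into itself.\<close>

definition field_endo :: "('a::field \<Rightarrow> 'a) \<Rightarrow> bool" where
  "field_endo h \<longleftrightarrow> h 1 = 1 \<and> (\<forall>x y. h (x + y) = h x + h y \<and> h (x * y) = h x * h y)"

lemma field_endo_simps:
  assumes "field_endo h"
  shows "h 1 = 1" "h 0 = 0" "h (x + y) = h x + h y" "h (x * y) = h x * h y" "h (- x) = - h x"
    "h (x - y) = h x - h y" "h (inverse x) = inverse (h x)" "h (x / y) = h x / h y"
    "h (x ^ m) = h x ^ m" "h (of_nat m) = of_nat m" "h (numeral w) = numeral w" "h x = 0 \<longleftrightarrow> x = 0"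
proof -
  show *: "h 1 = 1" "h (x + y) = h x + h y" "h (x * y) = h x * h y" for x y
    using assms by (auto simp: field_endo_def)
  have "h 0 + h 0 = h 0 + 0"
    using *(2)[of 0 0] by simp
  then show 0: "h 0 = 0"
    by (rule add_left_imp_eq)
  show neg: "h (- x) = - h x" for x
    using *(2)[of x "- x"] 0 by (simp add: add_eq_0_iff2)
  show "h (x - y) = h x - h y"
    using *(2)[of x "- y"] neg by simp
  show inv: "h (inverse x) = inverse (h x)" for x
    using *(3)[of x "inverse x"] * 0 by (cases "x = 0") (auto intro: inverse_unique[symmetric])
  show "h (x / y) = h x / h y"
    by (simp add: divide_inverse * inv)
  show "h (x ^ m) = h x ^ m"
    by (induction m) (simp_all add: *)
  show of_nat: "h (of_nat m) = of_nat m" for m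
    by (induction m) (simp_all add: * 0)
  show "h (numeral w) = numeral w"
    using of_nat[of "numeral w"] by simp
  show "h x = 0 \<longleftrightarrow> x = 0"
    using *(3)[of x "inverse x"] * 0 by (cases "x = 0") auto
qed

lemma is_subfield_fixed: "field_endo h \<Longrightarrow> is_subfield {x. h x = x}"
  by (auto simp: is_subfield_def field_endo_simps)

lemma field_endo_fixes_adjoin:
  assumes "field_endo h" "\<forall>x\<in>K. h x = x" "\<forall>x\<in>S. h x = x" "x \<in> adjoin K S"
  shows "h x = x"
  using adjoin_least[OF is_subfield_fixed[OF assms(1)], of K S] assms by blast

lemma field_endo_poly: "field_endo h \<Longrightarrow> h (poly p x) = poly (map_poly h p) (h x)"
  by (induction p) (simp_all add: field_endo_simps map_poly_pCons)

section \<open>Polynomials over a subfield and algebraic elements\<close>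

definition poly_over :: "'a::field set \<Rightarrow> 'a poly \<Rightarrow> bool" where
  "poly_over K p \<longleftrightarrow> (\<forall>i. Polynomial.coeff p i \<in> K)"

lemma poly_over_iff_coeffs:
  assumes "is_subfield K"
  shows "poly_over K p \<longleftrightarrow> set (Polynomial.coeffs p) \<subseteq> K"
proof
  assume "poly_over K p"
  then show "set (Polynomial.coeffs p) \<subseteq> K"
    by (auto simp: poly_over_def Polynomial.coeffs_def split: if_splits)
next
  assume "set (Polynomial.coeffs p) \<subseteq> K"
  then show "poly_over K p"
    unfolding poly_over_def using is_subfieldD(1)[OF assms]
    by (metis coeff_in_coeffs coeff_eq_0 coeff_0 not_le subsetD)
qed

lemma poly_over_pCons [simp]: "poly_over K (pCons c p) \<longleftrightarrow> c \<in> K \<and> poly_over K p"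
proof -
  have "poly_over K (pCons c p) \<longleftrightarrow> (\<forall>i. (case i of 0 \<Rightarrow> c | Suc j \<Rightarrow> Polynomial.coeff p j) \<in> K)"
    by (simp add: poly_over_def coeff_pCons)
  also have "\<dots> \<longleftrightarrow> c \<in> K \<and> poly_over K p"
    unfolding poly_over_def by (metis nat.case nat.exhaust)
  finally show ?thesis .
qed

lemma poly_over_closed:
  assumes "is_subfield K"
  shows "poly_over K 0" "poly_over K 1"
    "poly_over K p \<Longrightarrow> poly_over K q \<Longrightarrow> poly_over K (p + q)"
    "poly_over K p \<Longrightarrow> poly_over K q \<Longrightarrow> poly_over K (p - q)"
    "poly_over K p \<Longrightarrow> poly_over K (- p)"
    "poly_over K p \<Longrightarrow> poly_over K q \<Longrightarrow> poly_over K (p * q)"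
    "c \<in> K \<Longrightarrow> poly_over K p \<Longrightarrow> poly_over K (Polynomial.smult c p)"
    "c \<in> K \<Longrightarrow> poly_over K (Polynomial.monom c m)"
  using assms by (auto simp: poly_over_def is_subfieldD coeff_mult intro!: is_subfield_sum)

lemma poly_over_sum:
  "is_subfield K \<Longrightarrow> (\<And>i. i \<in> I \<Longrightarrow> poly_over K (f i)) \<Longrightarrow> poly_over K (sum f I)"
  by (induction I rule: infinite_finite_induct) (auto simp: poly_over_closed)

lemma poly_in_subfield: "is_subfield K \<Longrightarrow> poly_over K p \<Longrightarrow> x \<in> K \<Longrightarrow> poly p x \<in> K"
  by (induction p) (auto simp: is_subfieldD)

definition algebraic_over :: "'a::field set \<Rightarrow> 'a \<Rightarrow> bool" where
  "algebraic_over K x \<longleftrightarrow> (\<exists>p. p \<noteq> 0 \<and> poly_over K p \<and> poly p x = 0)"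

lemma algebraic_over_mono: "K \<subseteq> L \<Longrightarrow> algebraic_over K x \<Longrightarrow> algebraic_over L x"
  by (auto simp: algebraic_over_def poly_over_def)

lemma algebraic_over_self:
  assumes "is_subfield K" "x \<in> K"
  shows "algebraic_over K x"
  unfolding algebraic_over_def
  by (rule exI[of _ "[:-x, 1:]"]) (use assms in \<open>auto simp: is_subfieldD poly_over_closed\<close>)

text \<open>Coefficient lists in HOL-Algebra begin with the leading coefficient, those of
  \<open>Poly\<close> with the constant one; hence \<open>rev\<close>.\<close>

lemma eval_ring_of_type_algebra:
  "ring.eval ring_of_type_algebra p x = poly (Poly (rev p)) (x :: 'a::field)"
proof -
  interpret R: field "ring_of_type_algebra :: 'a ring"
    by (rule field_from_type_algebra)
  have pow: "x [^]\<^bsub>ring_of_type_algebra\<^esub> m = x ^ m" for m :: nat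
    by (induction m) (simp_all add: ring_of_type_algebra_simps)
  show ?thesis
  proof (induction p)
    case Nil
    then show ?case by (simp add: ring_of_type_algebra_simps)
  next
    case (Cons c p)
    then show ?case
      by (simp add: ring_of_type_algebra_simps Poly_append poly_monom pow)
  qed
qed

lemma algebraic_over_iff:
  assumes K: "is_subfield K"
  shows "algebraic_over K x \<longleftrightarrow> (ring.algebraic ring_of_type_algebra over K) x"
proof -
  interpret R: field "ring_of_type_algebra :: 'a ring"
    by (rule field_from_type_algebra)
  have ring: "subring K ring_of_type_algebra"
    using K by (simp add: is_subfield_iff_subfield subfieldE(1))
  show ?thesis
  proof
    assume "algebraic_over K x"
    then obtain p where p: "p \<noteq> 0" "poly_over K p" "poly p x = 0"
      by (auto simp: algebraic_over_def)
    have last: "last (Polynomial.coeffs p) \<noteq> 0"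
      using p by (simp add: last_coeffs_eq_coeff_degree)
    show "(R.algebraic over K) x"
    proof (rule R.algebraicI[where p = "rev (Polynomial.coeffs p)"])
      show "rev (Polynomial.coeffs p) \<in> carrier (K[X]\<^bsub>ring_of_type_algebra\<^esub>)"
        using p last poly_over_iff_coeffs[OF K, of p] by (auto simp: univ_poly_def polynomial_def ring_of_type_algebra_simps hd_rev)
    qed (use p in \<open>auto simp: eval_ring_of_type_algebra ring_of_type_algebra_simps\<close>)
  next
    assume "(R.algebraic over K) x"
    then obtain p where p: "p \<in> carrier (K[X]\<^bsub>ring_of_type_algebra\<^esub>)" "p \<noteq> []"
        "R.eval p x = \<zero>\<^bsub>ring_of_type_algebra\<^esub>"
      using R.algebraicE[OF ring] by (auto simp: ring_of_type_algebra_simps)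
    then have "set p \<subseteq> K" "hd p \<noteq> 0"
      by (auto simp: univ_poly_def polynomial_def ring_of_type_algebra_simps dest: hd_in_set)
    then have "Polynomial.coeffs (Poly (rev p)) = rev p"
      using p(2) by (cases p) simp_all
    with p \<open>set p \<subseteq> K\<close> show "algebraic_over K x"
      unfolding algebraic_over_def
      by (intro exI[of _ "Poly (rev p)"])
        (auto simp: poly_over_iff_coeffs[OF K] eval_ring_of_type_algebra ring_of_type_algebra_simps simp flip: coeffs_eq_Nil)
  qed
qed

text \<open>Finiteness of dimension passes through towers: \<open>L\<close>, which contains K(S), is
  finite over \<open>K\<close>, and \<open>z\<close> generates a finite extension of
  \<open>L\<close>, so \<open>z\<close> lies in a ring of finite dimension over
  \<open>K\<close>.\<close>

lemma algebraic_over_adjoin_finite: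
  assumes K: "is_subfield K" and S: "finite S" "\<And>y. y \<in> S \<Longrightarrow> algebraic_over K y"
    and z: "algebraic_over (adjoin K S) z"
  shows "algebraic_over K z"
proof -
  interpret R: field "ring_of_type_algebra :: 'a ring"
    by (rule field_from_type_algebra)
  note simps = ring_of_type_algebra_simps
  obtain xs where xs: "set xs = S"
    using finite_list[OF S(1)] by blast
  have alg: "(R.algebraic over K) y" if "y \<in> set xs" for y
    using S(2) K that xs by (simp flip: algebraic_over_iff)
  have K': "subfield K ring_of_type_algebra"
    using K by (simp add: is_subfield_iff_subfield)
  define L where "L = R.finite_extension K xs"
  have L: "subfield L ring_of_type_algebra"
    unfolding L_def by (rule R.finite_extension_is_subfield[OF K']) (simp_all add: simps alg)
  have "adjoin K S \<subseteq> L"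
    unfolding L_def
    using L R.finite_extension_incl[of K xs] R.finite_extension_mem[OF subfieldE(1)[OF K'], of xs] xs
    by (intro adjoin_least) (auto simp: is_subfield_iff_subfield L_def simps)
  then have "algebraic_over L z"
    using z algebraic_over_mono by blast
  then have z': "(R.algebraic over L) z"
    using L by (simp flip: algebraic_over_iff is_subfield_iff_subfield)
  have "R.finite_dimension L (R.simple_extension L z)"
    using R.finite_dimension_simple_extension[OF L, of z] z' by (simp add: simps)
  moreover have "R.finite_dimension K L"
    unfolding L_def by (rule R.finite_extension_finite_dimension(1)[OF K']) (simp_all add: simps alg)
  ultimately have "R.finite_dimension K (R.simple_extension L z)"
    using R.telescopic_base_dim(1)[OF K' L] by blast
  moreover have "subring (R.simple_extension L z) ring_of_type_algebra"
    by (rule R.simple_extension_is_subring[OF subfieldE(1)[OF L]]) (simp add: simps)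
  moreover have "z \<in> R.simple_extension L z"
    by (rule R.simple_extension_mem[OF subfieldE(1)[OF L]]) (simp add: simps)
  ultimately have "(R.algebraic over K) z"
    using R.finite_dimension_imp_algebraic[OF K'] by blast
  then show ?thesis
    using K by (simp add: algebraic_over_iff)
qed

text \<open>A polynomial with root \<open>z\<close> involves only finitely many elements of
  \<open>L\<close>, which reduces the claim to a finite adjunction.\<close>

lemma algebraic_over_trans:
  assumes "is_subfield K" "\<And>y. y \<in> L \<Longrightarrow> algebraic_over K y" "algebraic_over L z"
  shows "algebraic_over K z"
proof -
  obtain p where p: "p \<noteq> 0" "poly_over L p" "poly p z = 0"
    using assms(3) by (auto simp: algebraic_over_def)
  have "set (Polynomial.coeffs p) \<subseteq> L"
    using p by (auto simp: poly_over_def Polynomial.coeffs_def split: if_splits)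
  moreover have "algebraic_over (adjoin K (set (Polynomial.coeffs p))) z"
    unfolding algebraic_over_def poly_over_iff_coeffs[OF is_subfield_adjoin]
    by (rule exI[of _ p]) (use p in \<open>simp add: adjoin_gens\<close>)
  ultimately show ?thesis
    using algebraic_over_adjoin_finite[OF assms(1) finite_set, of "Polynomial.coeffs p" z] assms(2)
    by blast
qed

text \<open>If \<open>x\<close> and \<open>y\<close> are algebraic, so is every element of K(x, y)
  by the finite case; hence the algebraic elements form a subfield.\<close>

lemma algebraic_over_adjoin:
  assumes K: "is_subfield K" and S: "\<And>y. y \<in> S \<Longrightarrow> algebraic_over K y" and z: "z \<in> adjoin K S"
  shows "algebraic_over K z"
proof -
  have "is_subfield {z. algebraic_over K z}"
  proof -
    have *: "algebraic_over K z" if "algebraic_over K x" "algebraic_over K y" "z \<in> adjoin K {x, y}" for x y z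
      by (rule algebraic_over_adjoin_finite[OF K, of "{x, y}"])
        (use that in \<open>auto intro: algebraic_over_self is_subfield_adjoin\<close>)
    have mem: "x \<in> adjoin K {x, y}" "y \<in> adjoin K {x, y}" for x y
      by (auto intro: adjoin_genI)
    show ?thesis
      unfolding is_subfield_def
    proof (intro conjI ballI)
      show "0 \<in> {z. algebraic_over K z}" "1 \<in> {z. algebraic_over K z}"
        using algebraic_over_self[OF K] is_subfieldD(1,2)[OF K] by simp_all
    next
      fix x y assume "x \<in> {z. algebraic_over K z}" "y \<in> {z. algebraic_over K z}"
      then show "x + y \<in> {z. algebraic_over K z}" "x * y \<in> {z. algebraic_over K z}"
        using *[of x y "x + y"] *[of x y "x * y"] adjoin_closed(3,4)[OF mem] by simp_all
    next
      fix x assume "x \<in> {z. algebraic_over K z}"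
      then show "- x \<in> {z. algebraic_over K z}" "inverse x \<in> {z. algebraic_over K z}"
        using *[of x x "- x"] *[of x x "inverse x"] adjoin_closed(5,6)[OF mem(1)[of x x]] by simp_all
    qed
  qed
  then have "adjoin K S \<subseteq> {z. algebraic_over K z}"
    using K S by (intro adjoin_least) (auto intro: algebraic_over_self)
  then show ?thesis
    using z by blast
qed

section \<open>Simple extensions and the invariants they contain\<close>

lemma adjoin_single_fraction:
  assumes K: "is_subfield K" and f: "f \<in> adjoin K {t}"
  obtains p q where "poly_over K p" "poly_over K q" "poly q t \<noteq> 0" "f = poly p t / poly q t"
proof -
  let ?L = "{poly p t / poly q t | p q. poly_over K p \<and> poly_over K q \<and> poly q t \<noteq> 0}"
  have I: "x \<in> ?L" if "poly_over K p" "poly_over K q" "poly q t \<noteq> 0" "x = poly p t / poly q t" for x p q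
    using that by blast
  have "is_subfield ?L"
    unfolding is_subfield_def
  proof (intro conjI ballI)
    show "0 \<in> ?L"
      by (rule I[of 0 1]) (use K in \<open>simp_all add: poly_over_closed\<close>)
    show "1 \<in> ?L"
      by (rule I[of 1 1]) (use K in \<open>simp_all add: poly_over_closed\<close>)
  next
    fix x y assume "x \<in> ?L" "y \<in> ?L"
    then obtain p q p' q' where *: "poly_over K p" "poly_over K q" "poly q t \<noteq> 0" "x = poly p t / poly q t"
      "poly_over K p'" "poly_over K q'" "poly q' t \<noteq> 0" "y = poly p' t / poly q' t"
      by blast
    show "x + y \<in> ?L"
      by (rule I[of "p * q' + p' * q" "q * q'"]) (use * K in \<open>auto simp: poly_over_closed add_frac_eq\<close>)
    show "x * y \<in> ?L"
      by (rule I[of "p * p'" "q * q'"]) (use * K in \<open>auto simp: poly_over_closed\<close>)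
  next
    fix x assume x: "x \<in> ?L"
    then obtain p q where *: "poly_over K p" "poly_over K q" "poly q t \<noteq> 0" "x = poly p t / poly q t"
      by blast
    show "- x \<in> ?L"
      by (rule I[of "- p" "q"]) (use * K in \<open>auto simp: poly_over_closed\<close>)
    show "inverse x \<in> ?L"
    proof (cases "x = 0")
      case False
      then show ?thesis
        by (intro I[of q p]) (use * in auto)
    qed (use x in simp)
  qed
  moreover have "K \<subseteq> ?L"
  proof
    fix c assume "c \<in> K"
    then show "c \<in> ?L"
      by (intro I[of "[:c:]" 1]) (use K in \<open>auto simp: is_subfieldD poly_over_closed\<close>)
  qed
  moreover have "t \<in> ?L"
    by (intro I[of "[:0, 1:]" 1]) (use K in \<open>auto simp: is_subfieldD poly_over_closed\<close>)
  ultimately have "adjoin K {t} \<subseteq> ?L"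
    by (intro adjoin_least) auto
  then show thesis
    using f that by blast
qed

text \<open>The remainder modulo \<open>m\<close> is built one coefficient at a time, as in Horner's
  scheme, so that membership of the coefficients in \<open>K\<close> is visible at each
  step.\<close>

lemma poly_reduce_monic:
  assumes K: "is_subfield K" and m: "poly_over K m" "Polynomial.lead_coeff m = 1" "Polynomial.degree m > 0" "poly m t = 0"
    and p: "poly_over K p"
  obtains r where "poly_over K r" "Polynomial.degree r < Polynomial.degree m" "poly r t = poly p t"
proof -
  have "\<exists>r. poly_over K r \<and> Polynomial.degree r < Polynomial.degree m \<and> poly r t = poly p t"
    using p
  proof (induction p)
    case 0
    then show ?case using m K by (intro exI[of _ 0]) (auto simp: poly_over_closed)
  next
    case (pCons a p)
    from pCons(1,3) have a: "a \<in> K" "poly_over K p"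
      by simp_all
    then obtain r where r: "poly_over K r" "Polynomial.degree r < Polynomial.degree m" "poly r t = poly p t"
      using pCons by blast
    \<comment> \<open>\<open>pCons a r\<close> is a + X r, of degree at most that of
      \<open>m\<close>. As \<open>m\<close> is monic with root \<open>t\<close>, subtracting
      \<open>c\<close> times \<open>m\<close> removes the top coefficient and keeps the value at
      \<open>t\<close>.\<close>
    define c where "c = Polynomial.coeff (pCons a r) (Polynomial.degree m)"
    define s where "s = pCons a r - Polynomial.smult c m"
    have r': "poly_over K (pCons a r)"
      using a r by simp
    have deg: "Polynomial.degree s < Polynomial.degree m"
    proof -
      have "Polynomial.degree s \<le> Polynomial.degree m"
        unfolding s_def using r by (intro degree_diff_le) (auto simp: degree_pCons_eq_if)
      moreover have "Polynomial.coeff s (Polynomial.degree m) = 0"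
        using m by (simp add: s_def c_def)
      ultimately show ?thesis
        using m by (metis eq_zero_or_degree_less degree_0)
    qed
    have "c \<in> K"
      using r' K unfolding c_def by (simp add: poly_over_def)
    then have "poly_over K s"
      using r' K m by (simp add: s_def poly_over_closed)
    with deg show ?case
      using m r by (intro exI[of _ s]) (simp add: s_def)
  qed
  then show thesis using that by blast
qed

lemma fixed_in_base_field:
  assumes K: "is_subfield K" and T: "finite T" "t \<in> T" "poly_over K (\<Prod>u\<in>T. [:-u, 1:])"
    and h: "\<And>u. u \<in> T \<Longrightarrow> \<exists>h. field_endo h \<and> (\<forall>x\<in>K. h x = x) \<and> h t = u \<and> h f = f"
    and f: "f \<in> adjoin K {t}"
  shows "f \<in> K"
proof -
  define m where "m = (\<Prod>u\<in>T. [:-u, 1:])"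
  have m: "poly_over K m" "Polynomial.degree m = card T" "poly m t = 0"
    using T by (auto simp: m_def poly_prod prod_zero_iff degree_prod_eq_sum_degree)
  have lead: "Polynomial.lead_coeff m = 1"
    unfolding m_def lead_coeff_prod by simp
  have pos: "Polynomial.degree m > 0"
    using T m by (auto simp: card_gt_0_iff)
  obtain p' q' where pq': "poly_over K p'" "poly_over K q'" "poly q' t \<noteq> 0" "f = poly p' t / poly q' t"
    using adjoin_single_fraction[OF K f] by blast
  obtain p where p: "poly_over K p" "Polynomial.degree p < Polynomial.degree m" "poly p t = poly p' t"
    using poly_reduce_monic[OF K m(1) lead pos m(3) pq'(1)] by blast
  obtain q where q: "poly_over K q" "Polynomial.degree q < Polynomial.degree m" "poly q t = poly q' t"
    using poly_reduce_monic[OF K m(1) lead pos m(3) pq'(2)] by blast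
  define g where "g = Polynomial.smult f q - p"
  have map: "map_poly h r = r" if r: "poly_over K r" and h: "\<forall>x\<in>K. h x = x" for h r
  proof (rule poly_eqI)
    fix i
    have "h 0 = 0"
      using h is_subfieldD(1)[OF K] by blast
    then show "Polynomial.coeff (map_poly h r) i = Polynomial.coeff r i"
      using r h by (simp add: coeff_map_poly poly_over_def)
  qed
  have zero: "f * poly q t - poly p t = 0"
    using pq'(3,4) p(3) q(3) by simp
  have root: "poly g u = 0" if u: "u \<in> T" for u
  proof -
    obtain h where h: "field_endo h" "\<forall>x\<in>K. h x = x" "h t = u" "h f = f"
      using assms(5)[OF u] by blast
    have "poly g u = h f * h (poly q t) - h (poly p t)"
      using h(2,3,4) p(1) q(1) by (simp add: g_def field_endo_poly[OF h(1)] map)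
    also have "\<dots> = h (f * poly q t - poly p t)"
      by (simp add: field_endo_simps[OF h(1)])
    finally show ?thesis
      by (simp add: zero field_endo_simps[OF h(1)])
  qed
  have deg: "Polynomial.degree g < card T"
    using p q m unfolding g_def
    by (intro degree_diff_less) (auto intro: le_less_trans[OF degree_smult_le])
  have "g = 0"
  proof (rule ccontr)
    assume "g \<noteq> 0"
    then have "card T \<le> card {u. poly g u = 0}"
      using root by (intro card_mono poly_roots_finite) auto
    also have "\<dots> \<le> Polynomial.degree g"
      by (rule card_poly_roots_bound) fact
    finally show False using deg by simp
  qed
  then have eq: "Polynomial.smult f q = p"
    by (simp add: g_def)
  have "q \<noteq> 0"
    using q pq' by auto
  \<comment> \<open>The equality f q = p holds between polynomials and not just between their values
    at \<open>t\<close>, so \<open>f\<close> can be read off from coefficients, which lie in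
    \<open>K\<close>.\<close>
  then have "f = Polynomial.lead_coeff p / Polynomial.lead_coeff q"
    unfolding eq[symmetric] by (cases "f = 0") auto
  then show ?thesis
    using p q K by (simp add: poly_over_def is_subfieldD)
qed

section \<open>Descent of invariants and transcendence bases\<close>

text \<open>Stands in for \<open>L\<^sup>A = K\<close> with \<open>L\<close> algebraic over \<open>K\<close>, without requiring that \<open>A\<close> is a group
  or fixes \<open>K\<close>; this form composes along towers.\<close>

definition descends :: "('a::field \<Rightarrow> 'a) set \<Rightarrow> 'a set \<Rightarrow> 'a set \<Rightarrow> bool" where
  "descends A K L \<longleftrightarrow>
     (\<forall>f\<in>L. (\<forall>h\<in>A. h f = f) \<longrightarrow> f \<in> K) \<and> (\<forall>x\<in>L. algebraic_over K x)"

lemma descends_trans: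
  assumes "is_subfield K" "descends A K L" "descends A L M"
  shows "descends A K M"
proof -
  have "algebraic_over K x" if "x \<in> M" for x
    by (rule algebraic_over_trans[OF assms(1), of L]) (use assms(2,3) that in \<open>auto simp: descends_def\<close>)
  then show ?thesis
    using assms(2,3) by (simp add: descends_def)
qed

lemma descends_refl: "is_subfield K \<Longrightarrow> descends A K K"
  by (simp add: descends_def algebraic_over_self)

lemma descends_simple:
  assumes A: "\<And>h. h \<in> A \<Longrightarrow> field_endo h" and K: "is_subfield K"
    and T: "finite T" "t \<in> T" "poly_over K (\<Prod>u\<in>T. [:-u, 1:])"
    and h: "\<And>u. u \<in> T \<Longrightarrow> \<exists>h\<in>A. (\<forall>x\<in>K. h x = x) \<and> h t = u"
  shows "descends A K (adjoin K {t})"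
  unfolding descends_def
proof (intro conjI ballI impI)
  fix f assume f: "f \<in> adjoin K {t}" "\<forall>h\<in>A. h f = f"
  show "f \<in> K"
    by (rule fixed_in_base_field[OF K T _ f(1)]) (use A h f(2) in blast)
next
  fix x assume x: "x \<in> adjoin K {t}"
  have "algebraic_over K t"
    unfolding algebraic_over_def
    by (rule exI[of _ "\<Prod>u\<in>T. [:-u, 1:]"]) (use T in \<open>auto simp: poly_prod prod_zero_iff\<close>)
  then show "algebraic_over K x"
    using algebraic_over_adjoin[OF K _ x] by blast
qed

lemma descends_quadratic:
  assumes "\<And>h. h \<in> A \<Longrightarrow> field_endo h" "is_subfield K"
    and u: "t + u \<in> K" "t * u \<in> K" "t \<noteq> u"
    and h: "h0 \<in> A" "\<forall>x\<in>K. h0 x = x" "h0 t = t" "h1 \<in> A" "\<forall>x\<in>K. h1 x = x" "h1 t = u"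
  shows "descends A K (adjoin K {t})"
proof (rule descends_simple[where T = "{t, u}"])
  show "poly_over K (\<Prod>v\<in>{t, u}. [:- v, 1:])"
    using u is_subfieldD(5)[OF assms(2) u(1)] assms(2)
    by (simp add: poly_over_closed is_subfieldD algebra_simps)
qed (use assms in auto)

lemma descends_cubic:
  assumes "\<And>h. h \<in> A \<Longrightarrow> field_endo h" "is_subfield K"
    and u: "t + u + v \<in> K" "t * u + u * v + v * t \<in> K" "t * u * v \<in> K" "t \<noteq> u" "u \<noteq> v" "v \<noteq> t"
    and h: "h0 \<in> A" "\<forall>x\<in>K. h0 x = x" "h0 t = t" "h1 \<in> A" "\<forall>x\<in>K. h1 x = x" "h1 t = u"
      "h2 \<in> A" "\<forall>x\<in>K. h2 x = x" "h2 t = v"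
  shows "descends A K (adjoin K {t})"
proof (rule descends_simple[where T = "{t, u, v}"])
  have "(\<Prod>w\<in>{t, u, v}. [:- w, 1:]) = [:- (t * u * v), t * u + u * v + v * t, - (t + u + v), 1:]"
    using u(4-6) by (simp add: algebra_simps)
  then show "poly_over K (\<Prod>w\<in>{t, u, v}. [:- w, 1:])"
    using is_subfieldD(5)[OF assms(2) u(1)] is_subfieldD(5)[OF assms(2) u(3)] u(2) assms(2)
    by (simp only: poly_over_pCons poly_over_closed is_subfieldD simp_thms)
qed (use assms in auto)

text \<open>An upper bound on the number of invariants is enough: if \<open>m\<close> independent
  elements generate \<open>L\<close> over \<open>K\<close>, then exactly \<open>m\<close> elements
  in \<open>B\<close> and their independence follow.\<close>

definition has_rational_invariants ::
  "('a::field \<Rightarrow> 'a) set \<Rightarrow> 'a set \<Rightarrow> 'a set \<Rightarrow> nat \<Rightarrow> bool" where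
  "has_rational_invariants A K L m \<longleftrightarrow>
     (\<exists>B. finite B \<and> card B \<le> m \<and> B \<subseteq> L \<and> (\<forall>h\<in>A. \<forall>b\<in>B. h b = b) \<and>
       descends A (adjoin K B) L)"

text \<open>Passage to a quotient action: once the invariants of \<open>M\<close> are known to lie
  in \<open>L\<close>, only the action on \<open>L\<close> is left. It is applied with
  \<open>L\<close> generated by the invariants of a normal subgroup.\<close>

lemma has_rational_invariants_descends:
  assumes "has_rational_invariants A K L m" "descends A L M" "L \<subseteq> M"
  shows "has_rational_invariants A K M m"
  using assms unfolding has_rational_invariants_def
  by (meson descends_trans is_subfield_adjoin subset_trans)

text \<open>Invariants already found are counted as constants while the remaining ones are
  sought.\<close>

lemma has_rational_invariants_adjoin:
  assumes "has_rational_invariants A (adjoin K S) L m"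
    and "finite S" "S \<subseteq> L" "\<And>h b. h \<in> A \<Longrightarrow> b \<in> S \<Longrightarrow> h b = b"
  shows "has_rational_invariants A K L (card S + m)"
proof -
  obtain B where B: "finite B" "card B \<le> m" "B \<subseteq> L" "\<forall>h\<in>A. \<forall>b\<in>B. h b = b"
      "descends A (adjoin K (S \<union> B)) L"
    using assms(1) by (auto simp: has_rational_invariants_def adjoin_adjoin)
  then have "card (S \<union> B) \<le> card S + m"
    using card_Un_le[of S B] by linarith
  then show ?thesis
    unfolding has_rational_invariants_def using B assms(2-4) by (intro exI[of _ "S \<union> B"]) auto
qed

section \<open>Steinitz exchange and transcendence bases\<close>

lemma adjoin_single_common_denominator:
  assumes K: "is_subfield K" and f: "\<And>i::nat. i \<le> m \<Longrightarrow> f i \<in> adjoin K {t}"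
  shows "\<exists>q P. poly_over K q \<and> poly q t \<noteq> 0 \<and>
    (\<forall>i\<le>m. poly_over K (P i) \<and> f i * poly q t = poly (P i) t)"
  using f
proof (induction m)
  case 0
  obtain p q where "poly_over K p" "poly_over K q" "poly q t \<noteq> 0" "f 0 = poly p t / poly q t"
    using adjoin_single_fraction[OF K] 0 by blast
  then show ?case
    by (intro exI[of _ q] exI[of _ "\<lambda>_. p"]) auto
next
  case (Suc m)
  then obtain q P where *: "poly_over K q" "poly q t \<noteq> 0"
    "\<And>i. i \<le> m \<Longrightarrow> poly_over K (P i) \<and> f i * poly q t = poly (P i) t"
    by (metis le_Suc_eq)
  obtain p q' where pq: "poly_over K p" "poly_over K q'" "poly q' t \<noteq> 0" "f (Suc m) = poly p t / poly q' t"
    using adjoin_single_fraction[OF K Suc.prems[OF order_refl]] by blast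
  show ?case
    by (rule exI[of _ "q * q'"], rule exI[of _ "\<lambda>i. if i \<le> m then P i * q' else p * q"])
      (use * pq K in \<open>auto simp: poly_over_closed le_Suc_eq mult.assoc[symmetric]\<close>)
qed

text \<open>Clear denominators in a polynomial over L(x) with root \<open>y\<close>, and read the
  resulting relation in two variables the other way round, as a polynomial \<open>g\<close> in
  \<open>x\<close> with coefficients in L[y]. Because \<open>y\<close> is transcendental over
  \<open>L\<close>, \<open>g\<close> does not collapse to zero.\<close>

lemma algebraic_over_exchange:
  assumes y: "algebraic_over (adjoin K (insert x S)) y" "\<not> algebraic_over (adjoin K S) y"
  shows "algebraic_over (adjoin K (insert y S)) x"
proof -
  define L where "L = adjoin K S"
  have L: "is_subfield L"
    by (simp add: L_def is_subfield_adjoin)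
  have ins: "adjoin K (insert z S) = adjoin L {z}" for z
    by (simp add: L_def adjoin_adjoin)
  obtain p where p: "p \<noteq> 0" "poly_over (adjoin L {x}) p" "poly p y = 0"
    using y(1) by (auto simp: algebraic_over_def ins)
  define n where "n = Polynomial.degree p"
  obtain q P where q: "poly q x \<noteq> 0"
      and P: "\<And>i. i \<le> n \<Longrightarrow> poly_over L (P i)"
        "\<And>i. i \<le> n \<Longrightarrow> Polynomial.coeff p i * poly q x = poly (P i) x"
    using adjoin_single_common_denominator[OF L, of n "Polynomial.coeff p" x] p(2)
    by (auto simp: poly_over_def[of "adjoin L {x}"])
  define N where "N = Max ((\<lambda>i. Polynomial.degree (P i)) ` {..n})"
  have N: "Polynomial.degree (P i) \<le> N" if "i \<le> n" for i
    unfolding N_def using that by (intro Max_ge) auto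
  \<comment> \<open>\<open>P i\<close> is the coefficient of Y^i, a polynomial in X;
    \<open>R j\<close> is the coefficient of X^j, a polynomial in Y.\<close>
  define R where "R j = (\<Sum>i\<le>n. Polynomial.monom (Polynomial.coeff (P i) j) i)" for j
  have R: "poly_over L (R j)" for j
    unfolding R_def using P L by (intro poly_over_sum poly_over_closed) (auto simp: poly_over_def)
  define g where "g = (\<Sum>j\<le>N. Polynomial.monom (poly (R j) y) j)"
  have "poly (P n) x \<noteq> 0"
    using P(2)[of n] p q by (auto simp: n_def)
  then have "P n \<noteq> 0"
    by auto
  \<comment> \<open>For this \<open>j\<close> the polynomial \<open>R j\<close> contains the leading
    coefficient of \<open>P n\<close>, hence is not zero.\<close>
  define j where "j = Polynomial.degree (P n)"
  have j: "j \<le> N"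
    using N by (simp add: j_def)
  have "Polynomial.coeff (R j) n = Polynomial.lead_coeff (P n)"
    by (simp add: R_def coeff_sum j_def)
  then have "R j \<noteq> 0"
    using \<open>P n \<noteq> 0\<close> by auto
  then have "poly (R j) y \<noteq> 0"
    using y(2) R by (auto simp: algebraic_over_def L_def)
  moreover have "Polynomial.coeff g j = poly (R j) y"
    using j by (simp add: g_def coeff_sum)
  ultimately have "g \<noteq> 0"
    by auto
  moreover have "poly_over (adjoin L {y}) g"
  proof -
    have "poly (R j) y \<in> adjoin L {y}" for j
      using R[of j] adjoin_base[of L "{y}"] adjoin_genI[of y "{y}" L]
      by (intro poly_in_subfield is_subfield_adjoin) (auto simp: poly_over_def)
    then show ?thesis
      unfolding g_def by (intro poly_over_sum poly_over_closed is_subfield_adjoin)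
  qed
  moreover have "poly g x = 0"
  proof -
    have "poly g x = (\<Sum>j\<le>N. \<Sum>i\<le>n. Polynomial.coeff (P i) j * y ^ i * x ^ j)"
      by (simp add: g_def R_def poly_sum poly_monom sum_distrib_right)
    also have "\<dots> = (\<Sum>i\<le>n. (\<Sum>j\<le>N. Polynomial.coeff (P i) j * x ^ j) * y ^ i)"
      by (subst sum.swap) (simp add: sum_distrib_left sum_distrib_right mult_ac)
    also have "\<dots> = (\<Sum>i\<le>n. poly (P i) x * y ^ i)"
    proof (intro sum.cong refl arg_cong2[where f = "(*)"])
      fix i assume "i \<in> {..n}"
      then show "(\<Sum>j\<le>N. Polynomial.coeff (P i) j * x ^ j) = poly (P i) x"
        unfolding poly_altdef using N
        by (intro sum.mono_neutral_right) (auto simp: coeff_eq_0)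
    qed
    also have "\<dots> = poly q x * poly p y"
      by (simp add: poly_altdef[of p] n_def[symmetric] sum_distrib_left P(2)[symmetric] mult_ac)
    finally show ?thesis
      using p by simp
  qed
  ultimately show ?thesis
    unfolding ins algebraic_over_def by blast
qed

text \<open>Independence phrased through algebraic dependence alone, the form in which the exchange
  argument operates.\<close>

definition transcendence_free :: "'a::field set \<Rightarrow> 'a set \<Rightarrow> bool" where
  "transcendence_free K S \<longleftrightarrow> (\<forall>x\<in>S. \<not> algebraic_over (adjoin K (S - {x})) x)"

lemma algebraic_over_adjoin_trans:
  assumes "\<And>b. b \<in> B \<Longrightarrow> algebraic_over (adjoin K S) b" "algebraic_over (adjoin K B) z"
  shows "algebraic_over (adjoin K S) z"
proof -
  have "algebraic_over (adjoin K (S \<union> B)) z"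
    using assms(2) algebraic_over_mono adjoin_mono[of K K B "S \<union> B"] by blast
  then show ?thesis
    using algebraic_over_trans[OF is_subfield_adjoin, of "adjoin (adjoin K S) B" K S z]
      algebraic_over_adjoin[OF is_subfield_adjoin] assms(1)
    by (metis adjoin_adjoin)
qed

text \<open>Induction on the number of elements of \<open>I\<close> outside \<open>B\<close>: such
  an element is traded for one of \<open>B\<close>, keeping both the independence and the
  cardinality of \<open>I\<close>.\<close>

lemma steinitz:
  assumes "finite I" "finite B" "transcendence_free K I"
    and "\<And>x. x \<in> I \<Longrightarrow> algebraic_over (adjoin K B) x"
  shows "card I \<le> card B"
  using assms
proof (induction "card (I - B)" arbitrary: I rule: less_induct)
  case less
  show ?case
  proof (cases "I \<subseteq> B")
    case True
    then show ?thesis using less.prems by (intro card_mono)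
  next
    case False
    then obtain x where x: "x \<in> I" "x \<notin> B" by blast
    define J where "J = I - {x}"
    have xJ: "\<not> algebraic_over (adjoin K J) x"
      using less.prems(3) x by (simp add: transcendence_free_def J_def)
    \<comment> \<open>If every element of \<open>B\<close> were algebraic over K(J), transitivity
      would make \<open>x\<close> algebraic over K(J).\<close>
    then obtain b where b: "b \<in> B" "\<not> algebraic_over (adjoin K J) b"
      using algebraic_over_adjoin_trans[of B K J x] less.prems(4)[OF x(1)] by blast
    have "b \<notin> J"
      using b(2) algebraic_over_self[OF is_subfield_adjoin] adjoin_genI by blast
    define I' where "I' = insert b J"
    have I': "finite I'" "card I' = card I" "\<And>y. y \<in> I' \<Longrightarrow> algebraic_over (adjoin K B) y"
      using less.prems x b \<open>b \<notin> J\<close> algebraic_over_self[OF is_subfield_adjoin adjoin_genI]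
      by (auto simp: I'_def J_def card_Suc_Diff1 simp del: card_Diff_singleton card_Diff_insert)
    have "transcendence_free K I'"
      unfolding transcendence_free_def
    proof
      fix y assume y: "y \<in> I'"
      show "\<not> algebraic_over (adjoin K (I' - {y})) y"
      proof (cases "y = b")
        case True
        then show ?thesis using b(2) \<open>b \<notin> J\<close> by (simp add: I'_def)
      next
        case False
        then have "y \<in> J" using y by (simp add: I'_def)
        \<comment> \<open>If \<open>y\<close> were algebraic over \<open>b\<close> and the rest of
          \<open>J\<close>, exchange would make \<open>b\<close> algebraic over K(J).\<close>
        have eq: "I' - {y} = insert b (J - {y})"
          using False by (auto simp: I'_def)
        have "\<not> algebraic_over (adjoin K (I - {y})) y"
          using less.prems(3) \<open>y \<in> J\<close> by (auto simp: transcendence_free_def J_def)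
        moreover have "adjoin K (J - {y}) \<subseteq> adjoin K (I - {y})"
          by (intro adjoin_mono) (auto simp: J_def)
        ultimately have "\<not> algebraic_over (adjoin K (J - {y})) y"
          using algebraic_over_mono by blast
        moreover have "insert y (J - {y}) = J"
          using \<open>y \<in> J\<close> by blast
        ultimately show ?thesis
          using algebraic_over_exchange[of K b "J - {y}" y] b(2) unfolding eq by metis
      qed
    qed
    moreover have "I' - B \<subset> I - B"
      using x b by (auto simp: I'_def J_def)
    then have "card (I' - B) < card (I - B)"
      using less.prems(1) by (intro psubset_card_mono) auto
    ultimately show ?thesis
      using less.hyps[OF _ I'(1) less.prems(2) _ I'(3)] I'(2) by simp
  qed
qed

text \<open>A redundant element of \<open>B\<close> could be dropped, leaving fewer than
  \<open>card I\<close> elements over which all of \<open>I\<close> is algebraic, against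
  Steinitz.\<close>

lemma transcendence_free_generators:
  assumes "finite I" "finite B" "transcendence_free K I" "card B \<le> card I"
    and I: "\<And>x. x \<in> I \<Longrightarrow> algebraic_over (adjoin K B) x"
  shows "transcendence_free K B"
  unfolding transcendence_free_def
proof (intro ballI notI)
  fix b assume b: "b \<in> B" "algebraic_over (adjoin K (B - {b})) b"
  have "algebraic_over (adjoin K (B - {b})) c" if "c \<in> B" for c
    using that b algebraic_over_self[OF is_subfield_adjoin adjoin_genI, of c "B - {b}"] by (cases "c = b") auto
  then have "card I \<le> card (B - {b})"
    using assms algebraic_over_adjoin_trans[of B K "B - {b}"] by (intro steinitz[of I "B - {b}" K]) auto
  moreover have "card (B - {b}) < card B"
    using b assms(2) by (intro psubset_card_mono) auto
  ultimately show False
    using assms(4) by simp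
qed

section \<open>From \<open>transcendence_free\<close> to the absence of polynomial relations\<close>

lemma transcendence_free_subset:
  assumes "transcendence_free K S" "T \<subseteq> S"
  shows "transcendence_free K T"
proof -
  have "adjoin K (T - {x}) \<subseteq> adjoin K (S - {x})" for x
    using assms(2) by (intro adjoin_mono) auto
  then show ?thesis
    using assms algebraic_over_mono unfolding transcendence_free_def by blast
qed

text \<open>A relation is a polynomial in one element \<open>b\<close> over the field generated by
  the others, so each of its coefficients vanishes, and these are relations in fewer elements.
  Monomials are indexed by a set \<open>M\<close> with exponents \<open>e\<close>, so that fixing
  the exponent of \<open>b\<close> only means passing to a subset of \<open>M\<close>.\<close>

lemma transcendence_free_monomials:
  assumes "finite C" "transcendence_free K C" "finite M" "\<And>m. m \<in> M \<Longrightarrow> c m \<in> K"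
    and "\<And>m m'. m \<in> M \<Longrightarrow> m' \<in> M \<Longrightarrow> (\<forall>i\<in>C. e m i = e m' i) \<Longrightarrow> m = m'"
    and "(\<Sum>m\<in>M. c m * (\<Prod>i\<in>C. i ^ e m i)) = 0" "m \<in> M"
  shows "c m = 0"
  using assms
proof (induction C arbitrary: M m rule: finite_induct)
  case empty
  then have "M = {m}" by blast
  then show ?case using empty by simp
next
  case (insert b C)
  define L where "L = adjoin K C"
  have L: "is_subfield L" "K \<subseteq> L" "C \<subseteq> L"
    by (simp_all add: L_def is_subfield_adjoin adjoin_base adjoin_gens)
  define a where "a m = c m * (\<Prod>i\<in>C. i ^ e m i)" for m
  have a: "a m \<in> L" if "m \<in> M" for m
    unfolding a_def
    using L insert.prems(3)[OF that] by (intro is_subfieldD(4)[OF L(1)] is_subfield_prod is_subfieldD(9)) auto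
  define g where "g = (\<Sum>m\<in>M. Polynomial.monom (a m) (e m b))"
  have "poly g b = (\<Sum>m\<in>M. c m * (\<Prod>i\<in>insert b C. i ^ e m i))"
    using insert.hyps by (simp add: g_def a_def poly_sum poly_monom mult_ac)
  then have "poly g b = 0"
    using insert.prems(5) by simp
  moreover have "poly_over L g"
    unfolding g_def using a L by (intro poly_over_sum poly_over_closed) auto
  moreover have "\<not> algebraic_over L b"
    using insert.prems(1) insert.hyps by (simp add: transcendence_free_def L_def)
  ultimately have "g = 0"
    by (auto simp: algebraic_over_def)
  \<comment> \<open>The terms in which \<open>b\<close> has the same exponent as in
    \<open>m\<close>; the sum of their cofactors is a coefficient of \<open>g\<close>.\<close>
  define M' where "M' = {m' \<in> M. e m' b = e m b}"
  have "(\<Sum>m'\<in>M'. a m') = Polynomial.coeff g (e m b)"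
    using insert.prems(2) unfolding M'_def g_def
    by (simp add: coeff_sum sum.If_cases[symmetric] if_distrib sum.inter_filter)
  then have sum: "(\<Sum>m'\<in>M'. c m' * (\<Prod>i\<in>C. i ^ e m' i)) = 0"
    using \<open>g = 0\<close> by (simp add: a_def)
  show ?case
  proof (rule insert.IH[OF _ _ _ _ sum])
    show "transcendence_free K C"
      using insert.prems(1) transcendence_free_subset by blast
    show "m1 = m2" if "m1 \<in> M'" "m2 \<in> M'" "\<forall>i\<in>C. e m1 i = e m2 i" for m1 m2
      using that insert.prems(4)[of m1 m2] by (simp add: M'_def)
  qed (use insert.prems in \<open>auto simp: M'_def\<close>)
qed

lemma transcendence_free_imp_algebraically_independent:
  assumes "finite B" "transcendence_free K B"
  shows "algebraically_independent K B"
  unfolding algebraically_independent_def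
proof (intro allI impI, elim conjE)
  fix P :: "('a, 'a) mpoly"
  assume P: "\<forall>m. Poly_Mapping.lookup P m \<in> K" "\<forall>m\<in>Poly_Mapping.keys P. Poly_Mapping.keys m \<subseteq> B"
    "mpoly_eval (\<lambda>b. b) P = 0"
  have "(\<Prod>i\<in>B. i ^ Poly_Mapping.lookup m i) =
      (\<Prod>i\<in>Poly_Mapping.keys m. i ^ Poly_Mapping.lookup m i)" if "m \<in> Poly_Mapping.keys P" for m
    using P(2) that assms(1) by (intro prod.mono_neutral_right) (auto simp: in_keys_iff)
  then have sum: "(\<Sum>m\<in>Poly_Mapping.keys P. Poly_Mapping.lookup P m * (\<Prod>i\<in>B. i ^ Poly_Mapping.lookup m i)) = 0"
    using P(3) by (simp add: mpoly_eval_def)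
  have "Poly_Mapping.lookup P m = 0" if "m \<in> Poly_Mapping.keys P" for m
  proof (rule transcendence_free_monomials[OF assms finite_keys _ _ sum that])
    fix m m' :: "'a \<Rightarrow>\<^sub>0 nat"
    assume m: "m \<in> Poly_Mapping.keys P" "m' \<in> Poly_Mapping.keys P"
      and eq: "\<forall>i\<in>B. Poly_Mapping.lookup m i = Poly_Mapping.lookup m' i"
    show "m = m'"
    proof (rule poly_mapping_eqI)
      fix i
      show "Poly_Mapping.lookup m i = Poly_Mapping.lookup m' i"
      proof (cases "i \<in> B")
        case False
        then have "i \<notin> Poly_Mapping.keys m" "i \<notin> Poly_Mapping.keys m'"
          using P(2) m by blast+
        then show ?thesis by (simp add: in_keys_iff)
      qed (use eq in simp)
    qed
  qed (use P(1) in simp)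
  then show "P = 0"
    by (intro poly_mapping_eqI) (auto simp: in_keys_iff)
qed

section \<open>Permutation automorphisms and the independence of the variables\<close>

lemma field_endo_ratfun_permute: "bij s \<Longrightarrow> field_endo (ratfun_permute s)"
  by (simp add: field_endo_def ratfun_permute_one ratfun_permute_add ratfun_permute_mult)

lemma inj_ratfun_var: "inj (ratfun_var :: nat \<Rightarrow> 'k::field ratfun)"
proof (rule injI)
  fix i j
  assume "ratfun_var i = (ratfun_var j :: 'k ratfun)"
  then have "Poly_Mapping.single (Poly_Mapping.single i (1::nat)) (1::'k) =
      Poly_Mapping.single (Poly_Mapping.single j 1) 1"
    by (simp add: ratfun_var_def eq_fract)
  then show "i = j"
    by (metis lookup_single_eq lookup_single_not_eq one_neq_zero)
qed

text \<open>The transposition of \<open>i\<close> with a fresh index \<open>m\<close> fixes the other variables, so a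
  polynomial relation for \<open>x\<^sub>i\<close> over them would hold for infinitely many \<open>x\<^sub>m\<close>.\<close>

lemma transcendence_free_ratfun_var:
  assumes "finite V"
  shows "transcendence_free (range ratfun_const) (ratfun_var ` V :: 'k::field ratfun set)"
  unfolding transcendence_free_def
proof (intro ballI notI)
  fix x :: "'k ratfun"
  define L where "L = adjoin (range ratfun_const) (ratfun_var ` V - {x})"
  assume "x \<in> ratfun_var ` V" and "algebraic_over (adjoin (range ratfun_const) (ratfun_var ` V - {x})) x"
  then obtain i p where i: "i \<in> V" "x = ratfun_var i" and p: "p \<noteq> 0" "poly_over L p" "poly p x = 0"
    by (auto simp: algebraic_over_def L_def)
  have "poly p (ratfun_var m) = 0" if m: "m \<notin> V" for m
  proof -
    let ?h = "ratfun_permute (Transposition.transpose i m) :: 'k ratfun \<Rightarrow> _"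
    have h: "field_endo ?h" "?h (ratfun_var j) = ratfun_var (Transposition.transpose i m j)"
      "?h (ratfun_const c) = ratfun_const c" for j c
      by (simp_all add: field_endo_ratfun_permute ratfun_permute_var ratfun_permute_const)
    have "?h z = z" if "z \<in> L" for z
      by (rule field_endo_fixes_adjoin[OF h(1) _ _ that[unfolded L_def]])
        (use m i in \<open>auto simp: h transpose_def split: if_splits\<close>)
    then have "map_poly ?h p = p"
      using p(2) by (intro poly_eqI) (auto simp: coeff_map_poly poly_over_def field_endo_simps[OF h(1)])
    then show ?thesis
      using field_endo_poly[OF h(1), of p x] p(3) i by (simp add: h field_endo_simps(2)[OF h(1)])
  qed
  then have "ratfun_var ` (- V) \<subseteq> {z. poly p z = 0}"
    by blast
  then have "finite (ratfun_var ` (- V) :: 'k ratfun set)"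
    using poly_roots_finite[OF p(1)] finite_subset by blast
  then have "finite (- V)"
    using inj_ratfun_var finite_imageD inj_on_subset by (metis subset_UNIV)
  then show False
    using assms by (simp add: finite_compl)
qed

lemma rational_over_fixed_field:
  assumes G: "\<And>s. s \<in> G \<Longrightarrow> bij s"
    and inv: "has_rational_invariants (ratfun_permute ` G) (range ratfun_const)
      (ratfun_field n :: 'k::field ratfun set) n"
  shows "rational_over (range ratfun_const) (ratfun_fixed_field n G :: 'k ratfun set)"
proof -
  let ?K = "range ratfun_const :: 'k ratfun set"
  let ?V = "ratfun_var ` {1..n} :: 'k ratfun set"
  obtain B where B: "finite B" "card B \<le> n" "B \<subseteq> ratfun_field n"
    "\<forall>s\<in>G. \<forall>b\<in>B. ratfun_permute s b = b"
    and desc: "descends (ratfun_permute ` G) (adjoin ?K B) (ratfun_field n)"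
    using inv by (auto simp: has_rational_invariants_def)
  have "f \<in> ratfun_fixed_field n G" if f: "f \<in> adjoin ?K B" for f
  proof -
    have "adjoin ?K B \<subseteq> ratfun_field n"
      unfolding ratfun_field_def
      using B(3) by (intro adjoin_least is_subfield_adjoin adjoin_base) (simp add: ratfun_field_def)
    moreover have "ratfun_permute s f = f" if "s \<in> G" for s
      using G[OF that] B(4) that
      by (intro field_endo_fixes_adjoin[OF field_endo_ratfun_permute _ _ f]) (auto simp: ratfun_permute_const)
    ultimately show ?thesis
      using f by (auto simp: ratfun_fixed_field_def)
  qed
  moreover have "f \<in> adjoin ?K B" if "f \<in> ratfun_fixed_field n G" for f
    using desc that by (auto simp: descends_def ratfun_fixed_field_def)
  ultimately have eq: "ratfun_fixed_field n G = adjoin ?K B"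
    by blast
  have "card ?V = n"
    by (simp add: card_image inj_on_subset[OF inj_ratfun_var])
  moreover have "algebraic_over (adjoin ?K B) x" if "x \<in> ?V" for x
    using desc adjoin_genI[OF that] by (simp add: descends_def ratfun_field_def)
  ultimately have "transcendence_free ?K B"
    using B(1,2) transcendence_free_ratfun_var[OF finite_atLeastAtMost]
    by (intro transcendence_free_generators[of ?V B]) auto
  then have "algebraically_independent ?K B"
    using B(1) by (rule transcendence_free_imp_algebraically_independent[rotated])
  then show ?thesis
    using B(1) eq by (auto simp: rational_over_def finitely_generated_over_def purely_transcendental_over_def)
qed

section \<open>Rational invariants of permuted elements\<close>

text \<open>\<open>K\<close> is left open so that unmoved variables and known invariants can be
  absorbed into it. \<open>identity\<close> supplies \<open>t\<close> as one of its own
  conjugates.\<close>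

locale base_endos =
  fixes A :: "('a::field \<Rightarrow> 'a) set" and K :: "'a set"
  assumes endo: "h \<in> A \<Longrightarrow> field_endo h"
    and base: "h \<in> A \<Longrightarrow> c \<in> K \<Longrightarrow> h c = c"
    and identity: "(\<lambda>c. c) \<in> A"
begin

lemmas endo_simps = field_endo_simps[OF endo]

lemma fixes_adjoin: "h \<in> A \<Longrightarrow> \<forall>x\<in>S. h x = x \<Longrightarrow> \<forall>x\<in>adjoin K S. h x = x"
  using field_endo_fixes_adjoin[OF endo] base by blast

lemma base_endos_adjoin: "(\<And>h x. h \<in> A \<Longrightarrow> x \<in> S \<Longrightarrow> h x = x) \<Longrightarrow> base_endos A (adjoin K S)"
  using endo identity fixes_adjoin by unfold_locales blast+

lemma quadratic_step:
  assumes "h \<in> A" "\<forall>x\<in>S. h x = x"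
    and "t + h t \<in> adjoin K S" "t * h t \<in> adjoin K S" "h t \<noteq> t"
  shows "descends A (adjoin K S) (adjoin K (insert t S))"
proof -
  have "descends A (adjoin K S) (adjoin (adjoin K S) {t})"
    using assms fixes_adjoin[OF assms(1,2)] identity
    by (intro descends_quadratic[OF endo is_subfield_adjoin assms(3,4) _ identity]) auto
  then show ?thesis
    by (simp add: adjoin_adjoin)
qed

lemma cubic_step:
  assumes "g \<in> A" "\<forall>x\<in>S. g x = x" "g t = u" "h \<in> A" "\<forall>x\<in>S. h x = x" "h t = v"
    and "t + u + v \<in> adjoin K S" "t * u + u * v + v * t \<in> adjoin K S" "t * u * v \<in> adjoin K S"
    and "t \<noteq> u" "u \<noteq> v" "v \<noteq> t"
  shows "descends A (adjoin K S) (adjoin K (insert t S))"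
proof -
  have "descends A (adjoin K S) (adjoin (adjoin K S) {t})"
    using assms fixes_adjoin[OF assms(1,2)] fixes_adjoin[OF assms(4,5)] identity
    by (intro descends_cubic[OF endo is_subfield_adjoin assms(7-12) identity _ _ assms(1) _ _ assms(4)])
      auto
  then show ?thesis
    by (simp add: adjoin_adjoin)
qed

lemma has_rational_invariantsI:
  assumes "finite S" "card S \<le> m" "S \<subseteq> L" "\<And>h x. h \<in> A \<Longrightarrow> x \<in> S \<Longrightarrow> h x = x"
    and "descends A (adjoin K S) L"
  shows "has_rational_invariants A K L m"
  unfolding has_rational_invariants_def using assms by (intro exI[of _ S]) auto

text \<open>Adjoin the roots of the generic polynomial one at a time; each cofactor
  has coefficients in the field generated so far.\<close>

lemma symmetric_invariants:
  assumes T: "finite T" and A: "\<And>h. h \<in> A \<Longrightarrow> h ` T = T"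
    and tr: "\<And>t u. t \<in> T \<Longrightarrow> u \<in> T \<Longrightarrow> \<exists>h\<in>A. h t = u \<and> (\<forall>x\<in>T - {t, u}. h x = x)"
  shows "has_rational_invariants A K (adjoin K T) (card T)"
proof -
  define P where "P R = (\<Prod>u\<in>R. [:-u, 1:])" for R :: "'a set"
  \<comment> \<open>Up to sign, the elementary symmetric polynomials in the elements of
    \<open>T\<close>.\<close>
  define C where "C = Polynomial.coeff (P T) ` {..<card T}"
  have degP: "Polynomial.degree (P T) = card T"
    by (simp add: P_def degree_prod_eq_sum_degree)
  have leadP: "Polynomial.lead_coeff (P T) = 1"
    unfolding P_def lead_coeff_prod by simp
  have over: "poly_over L (P T)" if "is_subfield L" "C \<subseteq> L" for L
    unfolding poly_over_def
  proof
    fix i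
    consider "i < card T" | "i = card T" | "i > card T" by linarith
    then show "Polynomial.coeff (P T) i \<in> L"
    proof cases
      case 1
      then show ?thesis using that by (auto simp: C_def)
    next
      case 2
      then show ?thesis using that(1) leadP by (simp add: degP is_subfieldD)
    next
      case 3
      then show ?thesis using that(1) degP by (simp add: coeff_eq_0 is_subfieldD)
    qed
  qed
  have fixed: "h c = c" if h: "h \<in> A" and c: "c \<in> C" for h c
  proof -
    have "map_poly h (P R) = (\<Prod>u\<in>R. [:- h u, 1:])" for R
      unfolding P_def
    proof (induction R rule: infinite_finite_induct)
      case (insert u R)
      have "map_poly h ([:-u, 1:] * q) = [:- h u, 1:] * map_poly h q" for q
        by (rule poly_eqI) (simp add: coeff_map_poly coeff_pCons endo_simps[OF h] split: nat.splits)
      then show ?case using insert by simp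
    qed (simp_all add: endo_simps[OF h])
    also have "(\<Prod>u\<in>T. [:- h u, 1:]) = P T"
    proof -
      have "inj_on h T"
        using A[OF h] T by (simp add: eq_card_imp_inj_on)
      then show ?thesis
        using A[OF h] prod.reindex[of h T "\<lambda>u. [:- u, 1:]"] by (simp add: P_def)
    qed
    finally have "map_poly h (P T) = P T" .
    then have "h (Polynomial.coeff (P T) i) = Polynomial.coeff (P T) i" for i
      using coeff_map_poly[of h "P T" i] by (simp add: endo_simps[OF h])
    then show ?thesis
      using c by (auto simp: C_def)
  qed
  \<comment> \<open>Synthetic division by X - u uses nothing but \<open>u\<close> and the
    coefficients of the dividend, so the quotient stays over \<open>L\<close>.\<close>
  have cofactor: "poly_over L q" if "is_subfield L" "u \<in> L" "poly_over L ([:-u, 1:] * q)" for L u q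
  proof -
    have "q = synthetic_div ([:-u, 1:] * q) u"
      using synthetic_div_unique[where p = "[:-u, 1:] * q" and c = u and r = 0 and q = q] by simp
    moreover have "poly_over L (synthetic_div r u)" if "poly_over L r" for r
      using that \<open>is_subfield L\<close> \<open>u \<in> L\<close>
      by (induction r) (auto simp: poly_over_closed poly_in_subfield)
    ultimately show ?thesis using that(3) by metis
  qed
  \<comment> \<open>\<open>R\<close> holds the roots not yet adjoined; \<open>P R\<close> is what
    remains of \<open>P T\<close> after the linear factors of the adjoined roots are split
    off.\<close>
  have step: "descends A (adjoin K (C \<union> (T - R))) (adjoin K (C \<union> T))"
    if "finite R" "R \<subseteq> T" "poly_over (adjoin K (C \<union> (T - R))) (P R)" for R
    using that
  proof (induction R rule: finite_induct)
    case empty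
    then show ?case by (simp add: descends_refl is_subfield_adjoin)
  next
    case (insert t R)
    define L where "L = adjoin K (C \<union> (T - insert t R))"
    have L: "is_subfield L"
      by (simp add: L_def is_subfield_adjoin)
    have "descends A L (adjoin L {t})"
    proof (rule descends_simple[OF endo L, where T = "insert t R"])
      show "poly_over L (\<Prod>u\<in>insert t R. [:- u, 1:])"
        using insert.prems by (simp only: P_def L_def)
      fix u assume u: "u \<in> insert t R"
      \<comment> \<open>Both \<open>t\<close> and \<open>u\<close> are among the roots not yet
        adjoined, so \<open>h\<close> fixes all adjoined ones.\<close>
      then obtain h where h: "h \<in> A" "h t = u" "\<forall>x\<in>T - {t, u}. h x = x"
        using tr[of t u] insert.prems by blast
      then have "\<forall>x\<in>L. h x = x"
        unfolding L_def using u fixed[OF h(1)] by (intro fixes_adjoin) auto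
      with h show "\<exists>h\<in>A. (\<forall>x\<in>L. h x = x) \<and> h t = u"
        by blast
    qed (use insert.hyps in auto)
    moreover have eq: "adjoin L {t} = adjoin K (C \<union> (T - R))"
    proof -
      have "C \<union> (T - insert t R) \<union> {t} = C \<union> (T - R)"
        using insert by auto
      then show ?thesis
        by (simp add: L_def adjoin_adjoin)
    qed
    moreover have "poly_over (adjoin L {t}) (P R)"
    proof (rule cofactor[OF is_subfield_adjoin adjoin_genI[OF singletonI]])
      have "poly_over L ([:-t, 1:] * P R)"
        using insert by (simp add: P_def L_def)
      then show "poly_over (adjoin L {t}) ([:-t, 1:] * P R)"
        using adjoin_base unfolding poly_over_def by blast
    qed
    ultimately show ?case
      using insert.IH insert.prems descends_trans[OF L] unfolding L_def by simp
  qed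
  have "C \<subseteq> adjoin K T"
  proof -
    have "poly_over (adjoin K T) (P R)" if "finite R" "R \<subseteq> T" for R
      using that unfolding P_def
    proof (induction R rule: finite_induct)
      case (insert t R)
      then have "- t \<in> adjoin K T" "poly_over (adjoin K T) (\<Prod>u\<in>R. [:- u, 1:])"
        by (simp_all add: adjoin_closed adjoin_genI)
      then show ?case
        using insert.hyps
        by (simp del: mult_pCons_left add: poly_over_closed adjoin_closed is_subfield_adjoin)
    qed (simp add: poly_over_closed is_subfield_adjoin)
    then show ?thesis
      using T by (auto simp: C_def poly_over_def)
  qed
  moreover have "descends A (adjoin K C) (adjoin K T)"
  proof -
    have "adjoin K (C \<union> T) = adjoin K T"
      using adjoin_absorb[OF \<open>C \<subseteq> adjoin K T\<close>] by (simp add: Un_commute)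
    then show ?thesis
      using step[OF T order_refl] over[OF is_subfield_adjoin adjoin_gens] by simp
  qed
  moreover have "card C \<le> card T"
    unfolding C_def by (rule order_trans[OF card_image_le]) simp_all
  ultimately show ?thesis
    using fixed by (intro has_rational_invariantsI[where S = C]) (auto simp: C_def)
qed

section \<open>Groups preserving a partition of four elements into two pairs\<close>

lemma double_transposition_invariants:
  assumes A: "\<And>h. h \<in> A \<Longrightarrow> (h x, h y, h z, h w) \<in> {(x, y, z, w), (y, x, w, z)}"
    and h: "h \<in> A" "h x = y" and "x \<noteq> y"
  shows "has_rational_invariants A K (adjoin K {x, y, z, w}) 4"
proof (rule has_rational_invariantsI[where S = "{x + y, x * y, z + w, x * z + y * w}"])
  let ?S = "{x + y, x * y, z + w, x * z + y * w}"
  let ?L = "adjoin K {x, y, z, w}"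
  have mem: "x \<in> ?L" "y \<in> ?L" "z \<in> ?L" "w \<in> ?L"
    by (auto intro: adjoin_genI)
  then show S: "?S \<subseteq> ?L"
    by (auto intro: adjoin_closed)
  show fixed: "f z = z" if "f \<in> A" "z \<in> ?S" for f z
    using A[OF that(1)] that(2) by (auto simp: endo_simps[OF that(1)] algebra_simps)
  have "descends A (adjoin K ?S) (adjoin K (insert x ?S))"
    using fixed[OF h(1)] h assms(4) by (intro quadratic_step[OF h(1)]) (auto intro: adjoin_genI)
  also have "adjoin K (insert x ?S) = ?L"
  proof (rule adjoin_eqI)
    show "insert x ?S \<subseteq> ?L"
      using S mem by simp
    let ?M = "adjoin K (insert x ?S)"
    have x: "x \<in> ?M" and gens: "x + y \<in> ?M" "z + w \<in> ?M" "x * z + y * w \<in> ?M"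
      by (auto intro: adjoin_genI)
    have "y = x + y - x" by simp
    then have y: "y \<in> ?M"
      using x gens by (metis adjoin_closed(7))
    \<comment> \<open>Once \<open>x\<close> and \<open>y\<close> are known, \<open>z + w\<close> and
      \<open>x * z + y * w\<close> form a linear system for \<open>z\<close> and \<open>w\<close>
      with determinant \<open>y - x\<close>.\<close>
    have "w = (x * z + y * w - x * (z + w)) / (y - x)"
      using \<open>x \<noteq> y\<close> by (simp add: field_simps)
    moreover have "(x * z + y * w - x * (z + w)) / (y - x) \<in> ?M"
      using x y gens by (intro adjoin_closed(4,7,8)) auto
    ultimately have w: "w \<in> ?M" by simp
    have "z = z + w - w" by simp
    then have "z \<in> ?M"
      using w gens by (metis adjoin_closed(7))
    with x y w show "{x, y, z, w} \<subseteq> ?M" by simp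
  qed
  finally show "descends A (adjoin K ?S) ?L" .
qed (auto simp: card_insert_if)

text \<open>One quadratic step for each pair. As only \<open>g\<close> and \<open>h\<close> enter,
  the result also serves the larger dihedral group.\<close>

lemma two_transpositions_descends:
  assumes g: "g \<in> A" "g x = y" "g y = x" "g z = z" "g w = w"
    and h: "h \<in> A" "h x = x" "h y = y" "h z = w" "h w = z" and "x \<noteq> y" "z \<noteq> w"
  shows "descends A (adjoin K {x + y, z + w, x * y, z * w}) (adjoin K {x, y, z, w})"
proof -
  let ?S = "{x + y, z + w, x * y, z * w}"
  have "descends A (adjoin K ?S) (adjoin K (insert x ?S))"
    using assms by (intro quadratic_step[OF g(1)]) (auto intro: adjoin_genI simp: endo_simps mult.commute add.commute)
  moreover have "descends A (adjoin K (insert x ?S)) (adjoin K (insert z (insert x ?S)))"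
    using assms by (intro quadratic_step[OF h(1)]) (auto intro: adjoin_genI simp: endo_simps mult.commute add.commute)
  moreover have "adjoin K (insert z (insert x ?S)) = adjoin K {x, y, z, w}"
  proof (rule adjoin_eqI)
    show "insert z (insert x ?S) \<subseteq> adjoin K {x, y, z, w}"
      by (simp add: adjoin_closed adjoin_genI)
    have "x + y - x \<in> adjoin K (insert z (insert x ?S))" "z + w - z \<in> adjoin K (insert z (insert x ?S))"
      by (rule adjoin_closed(7); simp add: adjoin_genI)+
    then show "{x, y, z, w} \<subseteq> adjoin K (insert z (insert x ?S))"
      by (simp add: adjoin_genI)
  qed
  ultimately show ?thesis
    using descends_trans[OF is_subfield_adjoin] by metis
qed

lemma two_transpositions_invariants:
  assumes A: "\<And>h. h \<in> A \<Longrightarrow> (h x, h y, h z, h w) \<in> {(x, y, z, w), (y, x, z, w), (x, y, w, z), (y, x, w, z)}"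
    and g: "g \<in> A" "g x = y" "g z = z" and h: "h \<in> A" "h x = x" "h z = w" and ne: "x \<noteq> y" "z \<noteq> w"
  shows "has_rational_invariants A K (adjoin K {x, y, z, w}) 4"
proof (rule has_rational_invariantsI[where S = "{x + y, z + w, x * y, z * w}"])
  show "descends A (adjoin K {x + y, z + w, x * y, z * w}) (adjoin K {x, y, z, w})"
    by (rule two_transpositions_descends[OF g(1,2) _ g(3) _ h(1,2) _ h(3)])
      (use A[OF g(1)] A[OF h(1)] g h ne in auto)
  show "f u = u" if "f \<in> A" "u \<in> {x + y, z + w, x * y, z * w}" for f u
    using A[OF that(1)] that(2) by (auto simp: endo_simps[OF that(1)] algebra_simps)
  show "{x + y, z + w, x * y, z * w} \<subseteq> adjoin K {x, y, z, w}"
    by (simp add: adjoin_closed adjoin_genI)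
qed (auto simp: card_insert_if)

text \<open>The group is a wreath product. Its normal subgroup generated by \<open>g\<close> and
  \<open>h\<close> has the invariants \<open>x + y\<close>, \<open>z + w\<close>,
  \<open>x * y\<close>, \<open>z * w\<close>, and on these four the quotient acts as a double
  transposition, a case already settled.\<close>

lemma dihedral_invariants:
  assumes A: "\<And>h. h \<in> A \<Longrightarrow> (h x, h y, h z, h w) \<in> {(x, y, z, w), (y, x, z, w), (x, y, w, z), (y, x, w, z),
      (z, w, x, y), (w, z, x, y), (z, w, y, x), (w, z, y, x)}"
    and f: "f \<in> A" "f x = z" and g: "g \<in> A" "g x = y" "g z = z" and h: "h \<in> A" "h x = x" "h z = w"
    and ne: "x \<noteq> y" "z \<noteq> w" "x \<noteq> z" "y \<noteq> z" "x + y \<noteq> z + w"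
  shows "has_rational_invariants A K (adjoin K {x, y, z, w}) 4"
proof (rule has_rational_invariants_descends)
  show "descends A (adjoin K {x + y, z + w, x * y, z * w}) (adjoin K {x, y, z, w})"
    by (rule two_transpositions_descends[OF g(1,2) _ g(3) _ h(1,2) _ h(3)])
      (use A[OF g(1)] A[OF h(1)] g h ne in auto)
  show "has_rational_invariants A K (adjoin K {x + y, z + w, x * y, z * w}) 4"
  proof (rule double_transposition_invariants[OF _ f(1)])
    show "(k (x + y), k (z + w), k (x * y), k (z * w)) \<in>
        {(x + y, z + w, x * y, z * w), (z + w, x + y, z * w, x * y)}" if "k \<in> A" for k
      using A[OF that] by (auto simp: endo_simps[OF that] mult.commute add.commute)
    show "f (x + y) = z + w"
      using A[OF f(1)] f ne by (auto simp: endo_simps[OF f(1)])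
  qed (use ne in simp)
  show "adjoin K {x + y, z + w, x * y, z * w} \<subseteq> adjoin K {x, y, z, w}"
    by (intro adjoin_least is_subfield_adjoin adjoin_base) (simp add: adjoin_closed adjoin_genI)
qed

end

text \<open>This lemma and the next supply nonvanishing denominators and distinct conjugates below:
  the expressions are linear or monic quadratic in one element that is transcendental over the field
  of the others.\<close>

lemma transcendental_neq: "\<not> algebraic_over L x \<Longrightarrow> is_subfield L \<Longrightarrow> e \<in> L \<Longrightarrow> x \<noteq> e"
  using algebraic_over_self by blast

lemma transcendental_quadratic:
  assumes "\<not> algebraic_over L x" "is_subfield L" "p \<in> L" "q \<in> L"
  shows "x\<^sup>2 + p * x + q \<noteq> 0"
proof
  assume "x\<^sup>2 + p * x + q = 0"
  then have "poly [:q, p, 1:] x = 0"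
    by (simp add: power2_eq_square algebra_simps)
  then have "algebraic_over L x"
    unfolding algebraic_over_def
    using assms by (intro exI[of _ "[:q, p, 1:]"]) (simp add: is_subfieldD poly_over_closed)
  then show False using assms(1) by simp
qed

section \<open>The Klein four-group and the cyclic group of order three\<close>

context base_endos
begin

text \<open>Two quadratic steps adjoin \<open>a\<close> and \<open>c\<close>; the fourth invariant is affine in \<open>x\<close> with
  coefficient \<open>(a - b) (c - d)\<close>.\<close>

lemma klein_invariants:
  assumes A: "\<And>h. h \<in> A \<Longrightarrow> (h x, h y, h z, h w) \<in> {(x, y, z, w), (y, x, w, z), (z, w, x, y), (w, z, y, x)}"
    and g: "g \<in> A" "g x = y" and h: "h \<in> A" "h x = z"
    and x: "\<not> algebraic_over (adjoin K {y, z, w}) x" and ne: "y \<noteq> z" "y \<noteq> w" "z \<noteq> w"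
  shows "has_rational_invariants A K (adjoin K {x, y, z, w}) 4"
proof -
  define a b c d where "a = x + y" and "b = z + w" and "c = x + z" and "d = y + w"
  \<comment> \<open>The orbit sum of \<open>x * a * c\<close>. Because \<open>a + b = c + d\<close>,
    the pair sums contribute only the three invariants \<open>a + b\<close>, \<open>a * b\<close>
    and \<open>c * d\<close>.\<close>
  define q where "q = x * a * c + y * a * d + z * b * c + w * b * d"
  let ?S = "{a + b, a * b, c * d, q}"
  let ?L = "adjoin K {x, y, z, w}"
  have mem: "x \<in> ?L" "y \<in> ?L" "z \<in> ?L" "w \<in> ?L" and abcd: "a \<in> ?L" "b \<in> ?L" "c \<in> ?L" "d \<in> ?L"
    by (simp_all add: adjoin_genI adjoin_closed a_def b_def c_def d_def)
  have ne': "x \<noteq> z + w - y" "x \<noteq> y + w - z" "x \<noteq> y" "x \<noteq> z" "x \<noteq> w"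
    by (rule transcendental_neq[OF x is_subfield_adjoin]; simp add: adjoin_closed adjoin_genI)+
  have ab: "a \<noteq> b" and cd: "c \<noteq> d"
    using ne'(1,2) by (auto simp: a_def b_def c_def d_def algebra_simps)
  have fixed: "f u = u" if "f \<in> A" "u \<in> ?S" for f u
    using A[OF that(1)] that(2)
    by (auto simp: a_def b_def c_def d_def q_def endo_simps[OF that(1)] algebra_simps)
  have g': "g y = x" "g z = w" "g w = z"
    using A[OF g(1)] g(2) ne ne' by auto
  have h': "h y = w" "h z = x" "h w = y"
    using A[OF h(1)] h(2) ne ne' by auto
  have hg: "h a = b" "g a = a" "g c = d"
    using g g' h h' by (simp_all add: a_def b_def c_def d_def endo_simps add.commute)
  have cd_sum: "c + d = a + b"
    by (simp add: a_def b_def c_def d_def)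
  have "descends A (adjoin K ?S) (adjoin K (insert a ?S))"
    using fixed[OF h(1)] hg ab by (intro quadratic_step[OF h(1)]) (simp_all add: adjoin_genI)
  moreover have "descends A (adjoin K (insert a ?S)) (adjoin K (insert c (insert a ?S)))"
    using fixed[OF g(1)] hg cd by (intro quadratic_step[OF g(1)]) (simp_all add: adjoin_genI cd_sum)
  moreover have "adjoin K (insert c (insert a ?S)) = ?L"
  proof (rule adjoin_eqI)
    show "insert c (insert a ?S) \<subseteq> ?L"
      using mem abcd by (simp add: adjoin_closed q_def)
    let ?M = "adjoin K (insert c (insert a ?S))"
    have M: "a \<in> ?M" "c \<in> ?M" and q: "q \<in> ?M" and s: "a + b \<in> ?M"
      by (simp_all add: adjoin_genI)
    have "b = a + b - a" "d = a + b - c"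
      by (simp_all add: a_def b_def c_def d_def)
    then have M: "a \<in> ?M" "b \<in> ?M" "c \<in> ?M" "d \<in> ?M"
      using M adjoin_closed(7)[OF s] by metis+
    have yzw: "y = a - x" "z = c - x" "w = b - c + x"
      by (simp_all add: a_def b_def c_def)
    have "q = x * a * c + (a - x) * a * d + (c - x) * b * c + (b - c + x) * b * d"
      unfolding q_def by (simp only: yzw[symmetric])
    also have "\<dots> = x * ((a - b) * (c - d)) + a * a * d + c * b * c + (b - c) * b * d"
      by (simp add: algebra_simps)
    finally have "q = x * ((a - b) * (c - d)) + a * a * d + c * b * c + (b - c) * b * d" .
    then have "x = (q - a * a * d - c * b * c - (b - c) * b * d) / ((a - b) * (c - d))"
      using ab cd by simp
    moreover have "\<dots> \<in> ?M"
      by (intro adjoin_closed(4,7,8) M q)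
    ultimately have "x \<in> ?M"
      by metis
    moreover have "a - x \<in> ?M" "c - x \<in> ?M" "b - c + x \<in> ?M"
      using \<open>x \<in> ?M\<close> M by (simp_all add: adjoin_closed)
    ultimately show "{x, y, z, w} \<subseteq> ?M"
      by (simp flip: yzw)
  qed
  ultimately have "descends A (adjoin K ?S) ?L"
    using descends_trans[OF is_subfield_adjoin] by metis
  then show ?thesis
    using fixed mem abcd
    by (intro has_rational_invariantsI[where S = ?S]) (auto simp: card_insert_if adjoin_closed q_def)
qed

text \<open>The quotient \<open>a / b\<close> is a root of \<open>X\<^sup>3 - s X\<^sup>2 - (s + 3) X - 1\<close>, where \<open>s\<close> is the first
  invariant below.\<close>

lemma cyclic_plane_invariants:
  assumes A: "\<And>h. h \<in> A \<Longrightarrow> (h a, h b, h c) \<in> {(a, b, c), (b, c, a), (c, a, b)}"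
    and g: "g \<in> A" "(g a, g b, g c) = (b, c, a)" and h: "h \<in> A" "(h a, h b, h c) = (c, a, b)"
    and sum: "a + b + c = 0" and D: "a\<^sup>2 + a * b + b\<^sup>2 \<noteq> 0" and nz: "a \<noteq> 0" "b \<noteq> 0" "c \<noteq> 0"
  shows "has_rational_invariants A K (adjoin K {a, b, c}) 2"
proof -
  define D where "D = a\<^sup>2 + a * b + b\<^sup>2"
  define s where "s = a / b + b / c + c / a"
  \<comment> \<open>As \<open>a + b + c = 0\<close>, \<open>D\<close> is minus the second elementary
    symmetric polynomial. While \<open>s\<close> is homogeneous of degree zero, \<open>q\<close> has
    degree one and recovers the scale.\<close>
  define q where "q = a * b * c / D"
  let ?S = "{s, q}"
  let ?L = "adjoin K {a, b, c}"
  have mem: "a \<in> ?L" "b \<in> ?L" "c \<in> ?L"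
    by (simp_all add: adjoin_genI)
  have c: "c = - a - b"
    using sum by (simp add: eq_neg_iff_add_eq_0 algebra_simps)
  have D': "b\<^sup>2 + b * c + c\<^sup>2 = D" "c\<^sup>2 + c * a + a\<^sup>2 = D"
    by (simp_all add: D_def c power2_eq_square algebra_simps)
  have fixed: "f u = u" if "f \<in> A" "u \<in> ?S" for f u
    using A[OF that(1)] that(2) D'
    by (auto simp: s_def q_def D_def endo_simps[OF that(1)] ac_simps)
  have "a / b + b / c + c / a \<in> adjoin K ?S"
    by (simp add: adjoin_genI flip: s_def)
  moreover have "a / b * (b / c) + b / c * (c / a) + c / a * (a / b) \<in> adjoin K ?S"
  proof -
    have "a / b * (b / c) + b / c * (c / a) + c / a * (a / b) + s = (a + c) / b + (a + b) / c + (b + c) / a"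
      using nz by (simp add: s_def add_divide_distrib)
    also have "(a + c) / b + (a + b) / c + (b + c) / a = - b / b + - c / c + - a / a"
      by (intro arg_cong2[where f = "(+)"] arg_cong2[where f = "(/)"]) (simp_all add: c)
    also have "- b / b + - c / c + - a / a = - 3"
      using nz by simp
    finally have "a / b * (b / c) + b / c * (c / a) + c / a * (a / b) = - 3 - s"
      by (simp add: algebra_simps)
    then show ?thesis
      by (simp add: adjoin_closed adjoin_genI)
  qed
  moreover have "a / b * (b / c) * (c / a) \<in> adjoin K ?S"
    using nz by (simp add: adjoin_closed)
  \<comment> \<open>Each of the three equalities would force \<open>D = 0\<close>; for the first, a
    c - b^2 = -D.\<close>
  moreover have "a / b \<noteq> b / c" "b / c \<noteq> c / a" "c / a \<noteq> a / b"
    using nz D by (auto simp: field_simps c power2_eq_square eq_neg_iff_add_eq_0 neg_eq_iff_add_eq_0)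
  ultimately have desc: "descends A (adjoin K ?S) (adjoin K (insert (a / b) ?S))"
    using fixed[OF g(1)] fixed[OF h(1)] g h
    by (intro cubic_step[OF g(1) _ _ h(1)]) (simp_all add: endo_simps)
  have "adjoin K (insert (a / b) ?S) = ?L"
  proof (rule adjoin_eqI)
    show "insert (a / b) ?S \<subseteq> ?L"
      using mem by (simp add: adjoin_closed s_def q_def D_def)
    let ?M = "adjoin K (insert (a / b) ?S)"
    define t where "t = a / b"
    have tq: "t \<in> ?M" "q \<in> ?M"
      by (simp_all add: adjoin_genI t_def)
    have a: "a = t * b"
      using nz by (simp add: t_def)
    have t: "t \<noteq> 0" "t + 1 \<noteq> 0" "t\<^sup>2 + t + 1 \<noteq> 0"
    proof -
      show "t \<noteq> 0" using nz by (simp add: t_def)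
      have "c = (t + 1) * (- b)"
        by (simp add: c a algebra_simps)
      then show "t + 1 \<noteq> 0" using nz(3) by (metis mult_zero_left)
      have "a\<^sup>2 + a * b + b\<^sup>2 = (t\<^sup>2 + t + 1) * b\<^sup>2"
        by (simp add: a power2_eq_square algebra_simps)
      then show "t\<^sup>2 + t + 1 \<noteq> 0" using D by auto
    qed
    \<comment> \<open>By homogeneity \<open>q\<close> is \<open>b\<close> times a nonzero rational
      function of \<open>t\<close>, so \<open>b\<close> can be solved for.\<close>
    have "q = - (t * (t + 1) * b ^ 3) / ((t\<^sup>2 + t + 1) * b\<^sup>2)"
      by (simp add: q_def D_def c a power2_eq_square power3_eq_cube algebra_simps)
    also have "\<dots> = - (t * (t + 1) * b) / (t\<^sup>2 + t + 1)"
      using nz by (simp add: power2_eq_square power3_eq_cube)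
    finally have "q * (t\<^sup>2 + t + 1) = - (t * (t + 1) * b)"
      using t(3) by simp
    then have "b * (t * (t + 1)) = - q * (t\<^sup>2 + t + 1)"
      by (simp only: mult.commute[of b] mult_minus_left minus_minus)
    then have "b = - q * (t\<^sup>2 + t + 1) / (t * (t + 1))"
      using t by (simp only: nonzero_eq_divide_eq mult_eq_0_iff simp_thms)
    moreover have "\<dots> \<in> ?M"
      by (intro adjoin_closed tq)
    ultimately have "b \<in> ?M" by metis
    moreover have "a \<in> ?M"
      using \<open>b \<in> ?M\<close> tq by (simp add: a adjoin_closed)
    ultimately show "{a, b, c} \<subseteq> ?M"
      by (simp add: c adjoin_closed)
  qed
  with desc show ?thesis
    using fixed mem
    by (intro has_rational_invariantsI[where S = ?S])
      (auto simp: card_insert_if adjoin_closed s_def q_def D_def)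
qed

text \<open>The invariant \<open>u\<close> below moves by \<open>t\<close> when \<open>t\<close> is added to \<open>x\<close>, \<open>y\<close> and \<open>z\<close>, which reduces the
  problem to the differences.\<close>

lemma cyclic3_invariants:
  assumes A: "\<And>h. h \<in> A \<Longrightarrow> (h x, h y, h z) \<in> {(x, y, z), (y, z, x), (z, x, y)}"
    and g: "g \<in> A" "g x = y" and h: "h \<in> A" "h x = z"
    and x: "\<not> algebraic_over (adjoin K {y, z}) x" and "y \<noteq> z"
  shows "has_rational_invariants A K (adjoin K {x, y, z}) 3"
proof -
  define a b c where "a = y - x" and "b = z - y" and "c = x - z"
  define D where "D = x\<^sup>2 + y\<^sup>2 + z\<^sup>2 - x * y - y * z - z * x"
  \<comment> \<open>The mean of the three variables would also move by \<open>t\<close>, but not in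
    characteristic three. Here the term in x y z cancels the parts of order t^2 and t^3 in the
    numerator, and what is left is \<open>D\<close> times t, in every characteristic.\<close>
  define u where "u = (x\<^sup>2 * y + y\<^sup>2 * z + z\<^sup>2 * x - 3 * x * y * z) / D"
  let ?L = "adjoin K {x, y, z}"
  have mem: "x \<in> ?L" "y \<in> ?L" "z \<in> ?L"
    by (simp_all add: adjoin_genI)
  have "x \<noteq> y" "x \<noteq> z"
    by (rule transcendental_neq[OF x is_subfield_adjoin]; simp add: adjoin_genI)+
  have "D = x\<^sup>2 + (- (y + z)) * x + (y\<^sup>2 + z\<^sup>2 - y * z)"
    by (simp add: D_def algebra_simps)
  also have "\<dots> \<noteq> 0"
    by (intro transcendental_quadratic[OF x is_subfield_adjoin]) (simp_all add: adjoin_closed adjoin_genI)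
  finally have "D \<noteq> 0" .
  have D: "D = a\<^sup>2 + a * b + b\<^sup>2"
    by (simp add: D_def a_def b_def power2_eq_square algebra_simps)
  have u_fixed: "f u = u" if "f \<in> A" for f
    using A[OF that] by (auto simp: u_def D_def endo_simps[OF that] algebra_simps)
  interpret U: base_endos A "adjoin K {u}"
    using u_fixed by (intro base_endos_adjoin) simp
  have "has_rational_invariants A (adjoin K {u}) (adjoin (adjoin K {u}) {a, b, c}) 2"
  proof (rule U.cyclic_plane_invariants[OF _ g(1) _ h(1)])
    show "(f a, f b, f c) \<in> {(a, b, c), (b, c, a), (c, a, b)}" if "f \<in> A" for f
      using A[OF that] by (auto simp: a_def b_def c_def endo_simps[OF that])
    show "(g a, g b, g c) = (b, c, a)"
      using A[OF g(1)] g(2) \<open>x \<noteq> y\<close> \<open>y \<noteq> z\<close> by (auto simp: a_def b_def c_def endo_simps[OF g(1)])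
    show "(h a, h b, h c) = (c, a, b)"
      using A[OF h(1)] h(2) \<open>x \<noteq> z\<close> \<open>y \<noteq> z\<close> by (auto simp: a_def b_def c_def endo_simps[OF h(1)])
  qed (use \<open>D \<noteq> 0\<close> \<open>x \<noteq> y\<close> \<open>x \<noteq> z\<close> \<open>y \<noteq> z\<close> D in \<open>auto simp: a_def b_def c_def\<close>)
  moreover have "adjoin (adjoin K {u}) {a, b, c} = ?L"
    unfolding adjoin_adjoin
  proof (rule adjoin_eqI)
    show "{u} \<union> {a, b, c} \<subseteq> ?L"
      using mem by (simp add: adjoin_closed u_def D_def a_def b_def c_def)
    let ?M = "adjoin K ({u} \<union> {a, b, c})"
    have M: "u \<in> ?M" "a \<in> ?M" "b \<in> ?M" "D \<in> ?M"
      by (simp_all add: D adjoin_closed adjoin_genI)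
    \<comment> \<open>Translation of the point (0, a, a + b) by \<open>x\<close>: the numerator
      there is a^2 (a + b), and it grows by x D.\<close>
    have "x\<^sup>2 * y + y\<^sup>2 * z + z\<^sup>2 * x - 3 * x * y * z = x * D + a\<^sup>2 * (a + b)"
      by (simp add: D_def a_def b_def power2_eq_square algebra_simps)
    then have "x = u - a\<^sup>2 * (a + b) / D"
      using \<open>D \<noteq> 0\<close> by (simp add: u_def add_divide_distrib)
    moreover have "\<dots> \<in> ?M"
      using M by (simp add: adjoin_closed)
    ultimately have "x \<in> ?M" by metis
    moreover have "x + a \<in> ?M" "x + a + b \<in> ?M"
      using \<open>x \<in> ?M\<close> M by (simp_all add: adjoin_closed)
    ultimately show "{x, y, z} \<subseteq> ?M"
      by (simp add: a_def b_def)
  qed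
  ultimately have "has_rational_invariants A K ?L (card {u} + 2)"
    using u_fixed mem
    by (intro has_rational_invariants_adjoin) (simp_all add: adjoin_closed u_def D_def)
  then show ?thesis
    by (simp add: eval_nat_numeral)
qed

end

section \<open>The cyclic group of order four\<close>

context base_endos
begin

text \<open>The generator sends (u, v) to (v, -u) and swaps \<open>s\<close> with \<open>t\<close>;
  both u^2 - v^2 and u v change sign, so \<open>p\<close> is invariant without any square root of
  -1. The tower adjoins u^2, with conjugate v^2, and then \<open>u\<close>, with conjugate -u. After
  that \<open>p\<close> yields \<open>v\<close>, and \<open>s + t\<close> and \<open>r\<close> form
  a linear system for \<open>s\<close> and \<open>t\<close>. Division by 2 returns to the
  variables.\<close>

lemma cyclic4_invariants_odd:
  assumes A: "\<And>h. h \<in> A \<Longrightarrow> (h x, h y, h z, h w) \<in> {(x, y, z, w), (y, z, w, x), (z, w, x, y), (w, x, y, z)}"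
    and g: "g \<in> A" "g x = y" and h: "h \<in> A" "h x = z"
    and x: "\<not> algebraic_over (adjoin K {y, z, w}) x" and ne: "y \<noteq> z" "y \<noteq> w" "z \<noteq> w"
    and two: "(2 :: 'a) \<noteq> 0"
  shows "has_rational_invariants A K (adjoin K {x, y, z, w}) 4"
proof -
  define u v s t where "u = x - z" and "v = y - w" and "s = x + z" and "t = y + w"
  define p where "p = (u\<^sup>2 - v\<^sup>2) / (u * v)"
  define q where "q = u\<^sup>2 + v\<^sup>2"
  define r where "r = u\<^sup>2 * s + v\<^sup>2 * t"
  let ?S = "{p, q, s + t, r}"
  let ?L = "adjoin K {x, y, z, w}"
  have mem: "x \<in> ?L" "y \<in> ?L" "z \<in> ?L" "w \<in> ?L"
    by (simp_all add: adjoin_genI)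
  then have memS: "u \<in> ?L" "p \<in> ?L" "q \<in> ?L" "s + t \<in> ?L" "r \<in> ?L"
    by (simp_all add: p_def q_def r_def u_def v_def s_def t_def adjoin_closed)
  have ne': "x \<noteq> y" "x \<noteq> z" "x \<noteq> w"
    by (rule transcendental_neq[OF x is_subfield_adjoin]; simp add: adjoin_genI)+
  have u0: "u \<noteq> 0" and v0: "v \<noteq> 0"
    using ne ne' by (auto simp: u_def v_def)
  have "q = x\<^sup>2 + (- 2 * z) * x + (z\<^sup>2 + v\<^sup>2)"
    by (simp add: q_def u_def power2_eq_square algebra_simps)
  also have "\<dots> \<noteq> 0"
    by (intro transcendental_quadratic[OF x is_subfield_adjoin]) (simp_all add: adjoin_closed adjoin_genI v_def)
  finally have q0: "q \<noteq> 0" .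
  have "u\<^sup>2 - v\<^sup>2 = x\<^sup>2 + (- 2 * z) * x + (z\<^sup>2 - v\<^sup>2)"
    by (simp add: u_def power2_eq_square algebra_simps)
  also have "\<dots> \<noteq> 0"
    by (intro transcendental_quadratic[OF x is_subfield_adjoin]) (simp_all add: adjoin_closed adjoin_genI v_def)
  finally have uv: "u\<^sup>2 - v\<^sup>2 \<noteq> 0" .
  have A': "(f u, f v, f s, f t) \<in> {(u, v, s, t), (v, - u, t, s), (- u, - v, s, t), (- v, u, t, s)}"
    if "f \<in> A" for f
    using A[OF that] by (auto simp: u_def v_def s_def t_def endo_simps[OF that] add.commute)
  have p': "(v\<^sup>2 - u\<^sup>2) / (v * - u) = p"
    by (simp add: p_def mult.commute minus_divide_left)
  have fixed: "f c = c" if "f \<in> A" "c \<in> ?S" for f c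
  proof -
    have "f p = ((f u)\<^sup>2 - (f v)\<^sup>2) / (f u * f v)"
      by (simp add: p_def endo_simps[OF that(1)])
    then have "f p = p"
      using A'[OF that(1)] p' by (auto simp: p_def[symmetric])
    moreover have "f q = q" "f (s + t) = s + t" "f r = r"
      using A'[OF that(1)] by (auto simp: q_def r_def endo_simps[OF that(1)] add.commute)
    ultimately show ?thesis
      using that(2) by auto
  qed
  have gu: "g u = v"
    using A[OF g(1)] g(2) ne ne' by (auto simp: u_def v_def endo_simps[OF g(1)])
  have hu: "h u = - u"
    using A[OF h(1)] h(2) ne ne' by (auto simp: u_def v_def endo_simps[OF h(1)])
  \<comment> \<open>This rests on (u^2 - v^2)^2 + 4 u^2 v^2 = (u^2 + v^2)^2, which expresses the
    product of the conjugates u^2 and v^2 through the invariants.\<close>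
  have pq: "p\<^sup>2 + 4 = q\<^sup>2 / (u\<^sup>2 * v\<^sup>2)"
    using u0 v0 by (simp add: p_def q_def power2_eq_square field_simps)
  then have prod: "u\<^sup>2 * v\<^sup>2 = q\<^sup>2 / (p\<^sup>2 + 4)"
    using u0 v0 q0 by simp
  have "u\<^sup>2 + v\<^sup>2 \<in> adjoin K ?S"
    by (simp add: adjoin_genI flip: q_def)
  moreover have "u\<^sup>2 * v\<^sup>2 \<in> adjoin K ?S"
    unfolding prod by (intro adjoin_closed) (simp_all add: adjoin_genI)
  ultimately have "descends A (adjoin K ?S) (adjoin K (insert (u\<^sup>2) ?S))"
    using fixed[OF g(1)] gu uv by (intro quadratic_step[OF g(1)]) (simp_all add: endo_simps[OF g(1)])
  moreover have "descends A (adjoin K (insert (u\<^sup>2) ?S)) (adjoin K (insert u (insert (u\<^sup>2) ?S)))"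
  proof (rule quadratic_step[OF h(1)])
    have "u * h u = - u\<^sup>2"
      by (simp add: hu power2_eq_square)
    then show "u * h u \<in> adjoin K (insert (u\<^sup>2) ?S)"
      by (simp add: adjoin_closed adjoin_genI)
    have "u + u \<noteq> 0"
      using u0 two by (simp flip: mult_2)
    then show "h u \<noteq> u"
      by (simp add: hu neg_eq_iff_add_eq_0)
  qed (use fixed[OF h(1)] in \<open>simp_all add: hu endo_simps[OF h(1)] adjoin_closed\<close>)
  moreover have "adjoin K (insert u (insert (u\<^sup>2) ?S)) = ?L"
  proof (rule adjoin_eqI)
    show "insert u (insert (u\<^sup>2) ?S) \<subseteq> ?L"
      using memS by (simp add: adjoin_closed)
    let ?M = "adjoin K (insert u (insert (u\<^sup>2) ?S))"
    have M: "u \<in> ?M" "p \<in> ?M" "q \<in> ?M" "s + t \<in> ?M" "r \<in> ?M"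
      by (simp_all add: adjoin_genI)
    have v2: "v\<^sup>2 = q - u\<^sup>2"
      by (simp add: q_def)
    have "v = (u\<^sup>2 - v\<^sup>2) / (p * u)"
      using u0 v0 uv by (simp add: p_def)
    also have "\<dots> \<in> ?M"
      unfolding v2 by (intro adjoin_closed M)
    finally have v: "v \<in> ?M" .
    have "r - v\<^sup>2 * (s + t) = s * (u\<^sup>2 - v\<^sup>2)"
      by (simp add: r_def algebra_simps)
    then have "s = (r - v\<^sup>2 * (s + t)) / (u\<^sup>2 - v\<^sup>2)"
      using uv by simp
    moreover have "\<dots> \<in> ?M"
      by (intro adjoin_closed(4,7,8,9) M v)
    ultimately have s: "s \<in> ?M" by metis
    have "s + t - s \<in> ?M"
      by (intro adjoin_closed(7) M s)
    then have t: "t \<in> ?M" by simp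
    have "(s + u) / 2 \<in> ?M" "(s - u) / 2 \<in> ?M" "(t + v) / 2 \<in> ?M" "(t - v) / 2 \<in> ?M"
      by (intro adjoin_closed M s t v)+
    moreover have "(s + u) / 2 = x" "(s - u) / 2 = z" "(t + v) / 2 = y" "(t - v) / 2 = w"
      using two by (simp_all add: s_def u_def t_def v_def flip: mult_2)
    ultimately show "{x, y, z, w} \<subseteq> ?M"
      by simp
  qed
  ultimately have "descends A (adjoin K ?S) ?L"
    using descends_trans[OF is_subfield_adjoin] by metis
  then show ?thesis
    using fixed memS
    by (intro has_rational_invariantsI[where S = ?S]) (auto simp: card_insert_if)
qed

text \<open>In characteristic two, \<open>n\<close> and \<open>r\<close> below are both shifted by \<open>1\<close> under the generator of the
  cyclic group, and \<open>P\<close> by the invariant \<open>n\<^sup>2 + n\<close>; adding a multiple of \<open>r\<close> cancels the shifts.\<close>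

lemma cyclic4_invariants_even:
  assumes A: "\<And>h. h \<in> A \<Longrightarrow> (h x, h y, h z, h w) \<in> {(x, y, z, w), (y, z, w, x), (z, w, x, y), (w, x, y, z)}"
    and g: "g \<in> A" "g x = y" and h: "h \<in> A" "h x = z"
    and x: "\<not> algebraic_over (adjoin K {y, z, w}) x" and ne: "y \<noteq> z" "y \<noteq> w" "z \<noteq> w"
    and two: "(2 :: 'a) = 0"
  shows "has_rational_invariants A K (adjoin K {x, y, z, w}) 4"
proof -
  have dbl: "a + a = 0" for a :: 'a
    using two by (simp flip: mult_2)
  have neg: "- a = a" for a :: 'a
    using dbl[of a] by (simp add: neg_eq_iff_add_eq_0)
  have dbl': "a + (a + b) = b" for a b :: 'a
    by (simp add: dbl flip: add.assoc)
  define s t where "s = x + z" and "t = y + w"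
  \<comment> \<open>Artin-Schreier normalisation: z/s = x/s + 1 and w/t = y/t + 1, and
    \<open>P\<close> is (x/s)^2 + x/s.\<close>
  define n where "n = x / s + y / t"
  define P where "P = x * z / s\<^sup>2"
  define r where "r = s / (s + t)"
  let ?S = "{s + t, s * t, n + r, P + (n\<^sup>2 + n) * r}"
  let ?L = "adjoin K {x, y, z, w}"
  have mem: "x \<in> ?L" "y \<in> ?L" "z \<in> ?L" "w \<in> ?L" "s \<in> ?L" "t \<in> ?L" "n \<in> ?L" "P \<in> ?L" "r \<in> ?L"
    by (simp_all add: adjoin_genI adjoin_closed s_def t_def n_def P_def r_def)
  have ne': "x \<noteq> y" "x \<noteq> z" "x \<noteq> w" "x \<noteq> - z" "x \<noteq> y + w - z"
    by (rule transcendental_neq[OF x is_subfield_adjoin]; simp add: adjoin_genI adjoin_closed)+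
  have s0: "s \<noteq> 0" and t0: "t \<noteq> 0"
    using ne' ne neg by (simp_all only: s_def t_def add_eq_0_iff2 not_False_eq_True)
  have st: "s \<noteq> t"
    using ne'(5) by (simp add: s_def t_def eq_diff_eq)
  then have st0: "s + t \<noteq> 0"
    by (simp add: add_eq_0_iff2 neg)
  have zw: "z = x + s" "w = y + t"
    by (simp_all add: s_def t_def dbl')
  have n1: "y / t + z / s = n + 1" "w / t + x / s = n + 1" "z / s + w / t = n"
    using s0 t0 dbl[of 1] by (simp_all add: n_def zw add_divide_distrib algebra_simps)
  have sq: "(a + b)\<^sup>2 = a\<^sup>2 + b\<^sup>2" for a b :: 'a
    using two by (simp add: power2_sum)
  have P1: "y * w / t\<^sup>2 = P + (n\<^sup>2 + n)"
  proof -
    have *: "a * (a + b) / b\<^sup>2 = (a / b)\<^sup>2 + a / b" if "b \<noteq> 0" for a b :: 'a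
      using that by (simp add: power2_eq_square field_simps)
    have "P = (x / s)\<^sup>2 + x / s" "y * w / t\<^sup>2 = (y / t)\<^sup>2 + y / t"
      using *[OF s0] *[OF t0] by (simp_all only: P_def zw)
    then show ?thesis
      by (simp only: n_def sq ac_simps dbl')
  qed
  have r1: "t / (s + t) = 1 + r"
  proof -
    have "t / (s + t) + r = 1"
      using st0 by (simp add: r_def add.commute flip: add_divide_distrib)
    then have "t / (s + t) + (r + r) = 1 + r"
      by (simp only: flip: add.assoc)
    then show ?thesis
      by (simp add: dbl)
  qed
  \<comment> \<open>Even powers of the generator act trivially on these five elements, odd powers by
    the second tuple.\<close>
  have A': "(f s, f t, f n, f P, f r) \<in> {(s, t, n, P, r), (t, s, n + 1, P + (n\<^sup>2 + n), 1 + r)}"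
    if "f \<in> A" for f
  proof -
    have st: "f s = f x + f z" "f t = f y + f w" "f n = f x / f s + f y / f t"
      "f P = f x * f z / (f s)\<^sup>2" "f r = f s / (f s + f t)"
      by (simp_all add: s_def t_def n_def P_def r_def endo_simps[OF that])
    have r1': "t / (t + s) = 1 + r"
      using r1 by (simp add: add.commute)
    have "z + x = s" "w + y = t"
      by (simp_all add: s_def t_def add.commute)
    then show ?thesis
      using A[OF that]
      by (elim insertE emptyE)
        (simp_all add: st n1 P1 r1' flip: s_def t_def n_def P_def r_def,
         simp_all add: st n1 P1 r1' mult.commute[of z x] mult.commute[of w y] flip: s_def t_def n_def P_def r_def)
  qed
  have fixed: "f c = c" if "f \<in> A" "c \<in> ?S" for f c
  proof -
    have "(n + 1)\<^sup>2 + (n + 1) = n\<^sup>2 + n"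
      using dbl[of 1] by (simp add: sq ac_simps dbl')
    then have k: "f (n\<^sup>2 + n) = n\<^sup>2 + n"
      using A'[OF that(1)] by (auto simp: endo_simps[OF that(1)])
    have *: "P + k + k * (1 + r) = P + k * r" for k
      by (simp add: distrib_left ac_simps dbl')
    have "f (P + (n\<^sup>2 + n) * r) = f P + (n\<^sup>2 + n) * f r"
      by (simp only: k endo_simps(3)[OF that(1), of P] endo_simps(4)[OF that(1), of "n\<^sup>2 + n"])
    also have "\<dots> = P + (n\<^sup>2 + n) * r"
      using A'[OF that(1)] *[of "n\<^sup>2 + n"] by (elim insertE emptyE) (simp_all only: prod.inject)
    finally have "f (P + (n\<^sup>2 + n) * r) = P + (n\<^sup>2 + n) * r" .
    moreover have "f (n + r) = n + r" "f (s + t) = s + t" "f (s * t) = s * t"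
      using A'[OF that(1)] dbl[of 1] by (auto simp: endo_simps[OF that(1)] ac_simps dbl')
    ultimately show ?thesis
      using that(2) by auto
  qed
  have gs: "g s = t"
    using A[OF g(1)] g(2) ne ne' by (auto simp: s_def t_def endo_simps[OF g(1)])
  have hx: "h x = z" "h s = s"
    using A[OF h(1)] h(2) ne ne' by (auto simp: s_def t_def endo_simps[OF h(1)])
  have "descends A (adjoin K ?S) (adjoin K (insert s ?S))"
    using fixed[OF g(1)] st by (intro quadratic_step[OF g(1)]) (simp_all add: gs adjoin_genI)
  moreover have "descends A (adjoin K (insert s ?S)) (adjoin K (insert x (insert s ?S)))"
    and "adjoin K (insert x (insert s ?S)) = ?L"
  proof -
    \<comment> \<open>\<open>r\<close> is a rational function of \<open>s\<close> and
      \<open>s + t\<close>; once \<open>s\<close> is available, the corrections by \<open>r\<close>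
      can therefore be undone and \<open>n\<close> and \<open>P\<close> recovered.\<close>
    have M: "s \<in> M" "t \<in> M" "n \<in> M" "P \<in> M" if "is_subfield M" "insert s ?S \<subseteq> M" for M
    proof -
      have *: "s \<in> M" "s + t \<in> M" "n + r \<in> M" "P + (n\<^sup>2 + n) * r \<in> M"
        using that by auto
      then have "r \<in> M"
        using that(1) by (simp add: r_def is_subfieldD)
      moreover have "n + r - r \<in> M"
        by (rule is_subfieldD(7)[OF that(1)]) fact+
      then have "n \<in> M" by simp
      ultimately have "P + (n\<^sup>2 + n) * r - (n\<^sup>2 + n) * r \<in> M"
        by (intro is_subfieldD(3,4,7,9)[OF that(1)] *)
      moreover have "s + t - s \<in> M"
        by (rule is_subfieldD(7)[OF that(1)]) fact+
      ultimately show "s \<in> M" "t \<in> M" "n \<in> M" "P \<in> M"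
        using * \<open>n \<in> M\<close> by simp_all
    qed
    show "descends A (adjoin K (insert s ?S)) (adjoin K (insert x (insert s ?S)))"
    proof (rule quadratic_step[OF h(1)])
      have "x * h x = P * s\<^sup>2"
        using s0 by (simp add: hx P_def)
      then show "x * h x \<in> adjoin K (insert s ?S)"
        using M[OF is_subfield_adjoin adjoin_gens] by (simp only: adjoin_closed)
      show "x + h x \<in> adjoin K (insert s ?S)"
        by (simp add: hx adjoin_genI flip: s_def)
    qed (use fixed[OF h(1)] ne' hx in auto)
    show "adjoin K (insert x (insert s ?S)) = ?L"
    proof (rule adjoin_eqI)
      show "insert x (insert s ?S) \<subseteq> ?L"
        using mem by (simp add: adjoin_closed)
      let ?M = "adjoin K (insert x (insert s ?S))"
      have x: "x \<in> ?M"
        by (simp add: adjoin_genI)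
      have M': "s \<in> ?M" "t \<in> ?M" "n \<in> ?M" "P \<in> ?M"
        by (rule M[OF is_subfield_adjoin]; use adjoin_gens[of "insert x (insert s ?S)" K] in blast)+
      have "y = t * (n - x / s)"
        using t0 by (simp add: n_def)
      also have "\<dots> \<in> ?M"
        by (intro adjoin_closed(4,7,8) M' x)
      finally have "y \<in> ?M" .
      then show "{x, y, z, w} \<subseteq> ?M"
        using x M' by (simp add: zw adjoin_closed)
    qed
  qed
  ultimately have "descends A (adjoin K ?S) ?L"
    using descends_trans[OF is_subfield_adjoin] by metis
  then show ?thesis
    using fixed mem
    by (intro has_rational_invariantsI[where S = ?S]) (auto simp: card_insert_if adjoin_closed)
qed

end

text \<open>Makes the generators of an intermediate field independent, so that results requiring a
  transcendental element apply to them in place of the variables.\<close>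

lemma descends_transcendence_free:
  assumes I: "finite I" "transcendence_free K I" "card I = m"
    and B: "finite B" "card B \<le> m" "descends A (adjoin K B) (adjoin K I)"
  shows "transcendence_free K B" "card B = m"
proof -
  have alg: "algebraic_over (adjoin K B) x" if "x \<in> I" for x
    using B(3) adjoin_genI[OF that] by (simp add: descends_def)
  show "transcendence_free K B"
    using transcendence_free_generators[OF I(1) B(1) I(2) _ alg] B(2) I(3) by simp
  show "card B = m"
    using steinitz[OF I(1) B(1) I(2) alg] B(2) I(3) by simp
qed

section \<open>The alternating group of degree four\<close>

definition even_images :: "'b \<Rightarrow> 'b \<Rightarrow> 'b \<Rightarrow> 'b \<Rightarrow> ('b \<times> 'b \<times> 'b \<times> 'b) set" where
  "even_images x y z w =
    {(x, y, z, w), (y, x, w, z), (z, w, x, y), (w, z, y, x),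
     (x, z, w, y), (x, w, y, z), (z, y, w, x), (w, y, x, z),
     (y, w, z, x), (w, x, z, y), (y, z, x, w), (z, x, y, w)}"

context base_endos
begin

text \<open>The Klein four-group changes the signs of \<open>a\<close>, \<open>b\<close>, \<open>c\<close> below in pairs, so it fixes
  \<open>p\<close>, \<open>q\<close>, \<open>r\<close>, which the elements of order three permute cyclically.\<close>

lemma alternating4_invariants_odd:
  assumes A: "\<And>h. h \<in> A \<Longrightarrow> (h x, h y, h z, h w) \<in> even_images x y z w"
    and A': "\<And>i. i \<in> even_images x y z w \<Longrightarrow> \<exists>h\<in>A. (h x, h y, h z, h w) = i"
    and free: "transcendence_free K {x, y, z, w}" "card {x, y, z, w} = 4"
    and two: "(2 :: 'a) \<noteq> 0"
  shows "has_rational_invariants A K (adjoin K {x, y, z, w}) 4"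
proof -
  define T a b c where "T = x + y + z + w" and "a = x + y - z - w" and "b = x - y + z - w" and "c = x - y - z + w"
  \<comment> \<open>Chosen so that q r = a^2, r p = b^2 and p q = c^2: the field is regained by
    adjoining the square roots \<open>a\<close> and \<open>b\<close>, and then c = p a / b.\<close>
  define p q r where "p = b * c / a" and "q = c * a / b" and "r = a * b / c"
  let ?L = "adjoin K {x, y, z, w}"
  let ?S = "{T, p, q, r}"
  have mem: "x \<in> ?L" "y \<in> ?L" "z \<in> ?L" "w \<in> ?L"
    by (simp_all add: adjoin_genI)
  then have memS: "T \<in> ?L" "a \<in> ?L" "b \<in> ?L" "c \<in> ?L" "p \<in> ?L" "q \<in> ?L" "r \<in> ?L"
    by (simp_all add: adjoin_closed T_def a_def b_def c_def p_def q_def r_def)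
  have dist: "x \<noteq> y" "x \<noteq> z" "x \<noteq> w" "y \<noteq> z" "y \<noteq> w" "z \<noteq> w"
    using free(2) by (auto simp: card_insert_if split: if_splits)
  have "\<not> algebraic_over (adjoin K ({x, y, z, w} - {x})) x"
    using free(1) by (simp add: transcendence_free_def)
  also have "{x, y, z, w} - {x} = {y, z, w}"
    using dist by auto
  finally have x: "\<not> algebraic_over (adjoin K {y, z, w}) x" .
  have "x \<noteq> z + w - y" "x \<noteq> y - z + w" "x \<noteq> y + z - w"
    by (rule transcendental_neq[OF x is_subfield_adjoin]; simp add: adjoin_closed adjoin_genI)+
  then have nz: "a \<noteq> 0" "b \<noteq> 0" "c \<noteq> 0"
    by (auto simp: a_def b_def c_def algebra_simps)
  have abc: "(f a, f b, f c) \<in> {(a, b, c), (a, - b, - c), (- a, b, - c), (- a, - b, c),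
      (b, c, a), (b, - c, - a), (- b, c, - a), (- b, - c, a),
      (c, a, b), (c, - a, - b), (- c, a, - b), (- c, - a, b)}" "f T = T" if "f \<in> A" for f
    using A[OF that] unfolding even_images_def
    by (elim insertE emptyE; simp add: a_def b_def c_def T_def endo_simps[OF that] algebra_simps)+
  have pqr: "(f p, f q, f r) \<in> {(p, q, r), (q, r, p), (r, p, q)}" if "f \<in> A" for f
    using abc(1)[OF that] by (auto simp: p_def q_def r_def endo_simps[OF that] mult.commute)
  obtain f where f: "f \<in> A" "(f x, f y, f z, f w) = (z, w, x, y)"
    using A'[of "(z, w, x, y)"] by (auto simp: even_images_def)
  obtain e where e: "e \<in> A" "(e x, e y, e z, e w) = (y, x, w, z)"
    using A'[of "(y, x, w, z)"] by (auto simp: even_images_def)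
  obtain g where g: "g \<in> A" "(g x, g y, g z, g w) = (x, z, w, y)"
    using A'[of "(x, z, w, y)"] by (auto simp: even_images_def)
  obtain h where h: "h \<in> A" "(h x, h y, h z, h w) = (x, w, y, z)"
    using A'[of "(x, w, y, z)"] by (auto simp: even_images_def)
  have fa: "f a = - a" "f b = b" "f c = - c"
    using f by (simp_all add: a_def b_def c_def endo_simps)
  have ea: "e a = a" "e b = - b" "e c = - c"
    using e by (simp_all add: a_def b_def c_def endo_simps)
  have ga: "g a = b" "g b = c" "g c = a"
    using g by (simp_all add: a_def b_def c_def endo_simps)
  have ha: "h a = c" "h b = a" "h c = b"
    using h by (simp_all add: a_def b_def c_def endo_simps)
  have fS: "\<forall>u\<in>?S. f u = u"
    using abc(2)[OF f(1)] nz by (simp add: p_def q_def r_def fa endo_simps[OF f(1)])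
  have eS: "\<forall>u\<in>?S. e u = u"
    using abc(2)[OF e(1)] nz by (simp add: p_def q_def r_def ea endo_simps[OF e(1)])
  have neg: "- u \<noteq> u" if "u \<noteq> 0" for u :: 'a
    using that two by (simp add: neg_eq_iff_add_eq_0 flip: mult_2)
  have desc: "descends A (adjoin K ?S) ?L"
  proof -
    have "descends A (adjoin K ?S) (adjoin K (insert a ?S))"
    proof (rule quadratic_step[OF f(1) fS])
      have "a * f a = - (q * r)"
        using nz by (simp add: fa q_def r_def)
      then show "a * f a \<in> adjoin K ?S"
        by (simp add: adjoin_closed adjoin_genI)
    qed (use neg nz in \<open>simp_all add: fa adjoin_closed\<close>)
    moreover have "descends A (adjoin K (insert a ?S)) (adjoin K (insert b (insert a ?S)))"
    proof (rule quadratic_step[OF e(1)])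
      have "b * e b = - (p * r)"
        using nz by (simp add: ea p_def r_def)
      then show "b * e b \<in> adjoin K (insert a ?S)"
        by (simp add: adjoin_closed adjoin_genI)
      show "\<forall>u\<in>insert a ?S. e u = u"
        using eS ea by simp
    qed (use neg nz in \<open>simp_all add: ea adjoin_closed\<close>)
    moreover have "adjoin K (insert b (insert a ?S)) = ?L"
    proof (rule adjoin_eqI)
      show "insert b (insert a ?S) \<subseteq> ?L"
        using memS by simp
      let ?M = "adjoin K (insert b (insert a ?S))"
      have M: "T \<in> ?M" "a \<in> ?M" "b \<in> ?M" "p \<in> ?M"
        by (simp_all add: adjoin_genI)
      have "c = p * a / b"
        using nz by (simp add: p_def)
      also have "\<dots> \<in> ?M"
        by (intro adjoin_closed M)
      finally have "(T + a + b + c) / 4 \<in> ?M" "(T + a - b - c) / 4 \<in> ?M"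
          "(T - a + b - c) / 4 \<in> ?M" "(T - a - b + c) / 4 \<in> ?M"
        by (intro adjoin_closed M; assumption)+
      moreover have "4 = (2 :: 'a) * 2"
        by simp
      then have "4 \<noteq> (0 :: 'a)"
        using two by (metis mult_eq_0_iff)
      then have "(T + a + b + c) / 4 = x" "(T + a - b - c) / 4 = y"
          "(T - a + b - c) / 4 = z" "(T - a - b + c) / 4 = w"
        by (simp_all add: T_def a_def b_def c_def)
      ultimately show "{x, y, z, w} \<subseteq> ?M"
        by simp
    qed
    ultimately show ?thesis
      using descends_trans[OF is_subfield_adjoin] by metis
  qed
  have "card ?S \<le> 4"
    by (simp add: card_insert_if)
  \<comment> \<open>With this independence \<open>p\<close> is transcendental over \<open>T\<close>,
    \<open>q\<close>, \<open>r\<close>, as the cyclic case of order three demands over the base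
    K(T).\<close>
  then have trans: "transcendence_free K ?S" "card ?S = 4"
    using descends_transcendence_free[OF _ free _ _ desc] by simp_all
  have distS: "p \<noteq> q" "q \<noteq> r" "r \<noteq> p" "p \<noteq> T" 
    using trans(2) by (auto simp: card_insert_if split: if_splits)
  have "{T, p, q, r} - {p} = {T, q, r}"
    using distS by auto
  then have "\<not> algebraic_over (adjoin K {T, q, r}) p"
    using trans(1) by (auto simp: transcendence_free_def)
  then have p: "\<not> algebraic_over (adjoin (adjoin K {T}) {q, r}) p"
    by (simp add: adjoin_adjoin insert_commute)
  interpret T: base_endos A "adjoin K {T}"
    using abc(2) by (intro base_endos_adjoin) simp
  have "has_rational_invariants A (adjoin K {T}) (adjoin (adjoin K {T}) {p, q, r}) 3"
    by (rule T.cyclic3_invariants[OF pqr g(1) _ h(1) _ p])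
      (use distS in \<open>simp_all add: p_def q_def r_def ga ha endo_simps[OF g(1)] endo_simps[OF h(1)] mult.commute\<close>)
  moreover have "adjoin (adjoin K {T}) {p, q, r} = adjoin K ?S"
    by (simp add: adjoin_adjoin insert_commute)
  moreover have S_L: "adjoin K ?S \<subseteq> ?L"
    using memS by (intro adjoin_least is_subfield_adjoin adjoin_base) simp
  ultimately have "has_rational_invariants A (adjoin K {T}) ?L 3"
    using has_rational_invariants_descends[OF _ desc S_L] by simp
  then have "has_rational_invariants A K ?L (card {T} + 3)"
    by (rule has_rational_invariants_adjoin) (use abc(2) memS in simp_all)
  then show ?thesis
    by (simp add: eval_nat_numeral)
qed

text \<open>In characteristic two the three invariants \<open>a\<close>, \<open>b\<close>, \<open>c\<close> below of the Klein four-group sum to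
  zero, and the second elementary symmetric polynomial is affine in \<open>x\<close> over \<open>k(x + y, x + z, T)\<close>.\<close>

lemma alternating4_invariants_even:
  assumes A: "\<And>h. h \<in> A \<Longrightarrow> (h x, h y, h z, h w) \<in> even_images x y z w"
    and A': "\<And>i. i \<in> even_images x y z w \<Longrightarrow> \<exists>h\<in>A. (h x, h y, h z, h w) = i"
    and free: "transcendence_free K {x, y, z, w}" "card {x, y, z, w} = 4"
    and two: "(2 :: 'a) = 0"
  shows "has_rational_invariants A K (adjoin K {x, y, z, w}) 4"
proof -
  have dbl: "a + a = 0" for a :: 'a
    using two by (simp flip: mult_2)
  have dbl': "a + (a + b) = b" for a b :: 'a
    by (simp add: dbl flip: add.assoc)
  define T E where "T = x + y + z + w" and "E = x * y + x * z + x * w + y * z + y * w + z * w"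
  define a b c where "a = (x + y) * (z + w)" and "b = (x + z) * (y + w)" and "c = (x + w) * (y + z)"
  let ?L = "adjoin K {x, y, z, w}"
  let ?S = "{T, E, a, b}"
  have mem: "x \<in> ?L" "y \<in> ?L" "z \<in> ?L" "w \<in> ?L"
    by (simp_all add: adjoin_genI)
  then have memS: "T \<in> ?L" "E \<in> ?L" "a \<in> ?L" "b \<in> ?L" "c \<in> ?L"
    by (simp_all add: adjoin_closed T_def E_def a_def b_def c_def)
  have dist: "x \<noteq> y" "x \<noteq> z" "x \<noteq> w" "y \<noteq> z" "y \<noteq> w" "z \<noteq> w"
    using free(2) by (auto simp: card_insert_if split: if_splits)
  have "\<not> algebraic_over (adjoin K ({x, y, z, w} - {x})) x"
    using free(1) by (simp add: transcendence_free_def)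
  also have "{x, y, z, w} - {x} = {y, z, w}"
    using dist by auto
  finally have x: "\<not> algebraic_over (adjoin K {y, z, w}) x" .
  have "x \<noteq> - (y + z + w)"
    by (rule transcendental_neq[OF x is_subfield_adjoin]; simp only: adjoin_closed adjoin_genI insert_iff simp_thms)
  then have T0: "T \<noteq> 0"
    by (simp only: T_def add.assoc add_eq_0_iff2 not_False_eq_True)
  have abc: "(f a, f b, f c) \<in> {(a, b, c), (b, c, a), (c, a, b)}" if "f \<in> A" for f
    using A[OF that] unfolding even_images_def
    by (elim insertE emptyE; simp add: a_def b_def c_def endo_simps[OF that] ac_simps)
  have TE: "f T = T" "f E = E" if "f \<in> A" for f
    using A[OF that] unfolding even_images_def
    by (elim insertE emptyE; simp add: T_def E_def endo_simps[OF that] ac_simps)+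
  \<comment> \<open>The sum is twice \<open>E\<close>. This loss of \<open>E\<close> is why it is
    kept as an invariant of its own, beside \<open>T\<close> and two invariants from the plane
    \<open>a + b + c = 0\<close>.\<close>
  have sum: "a + b + c = 0"
    by (simp add: a_def b_def c_def algebra_simps dbl dbl')
  obtain f where f: "f \<in> A" "(f x, f y, f z, f w) = (z, w, x, y)"
    using A'[of "(z, w, x, y)"] by (auto simp: even_images_def)
  obtain e where e: "e \<in> A" "(e x, e y, e z, e w) = (y, x, w, z)"
    using A'[of "(y, x, w, z)"] by (auto simp: even_images_def)
  obtain g where g: "g \<in> A" "(g x, g y, g z, g w) = (x, z, w, y)"
    using A'[of "(x, z, w, y)"] by (auto simp: even_images_def)
  obtain h where h: "h \<in> A" "(h x, h y, h z, h w) = (x, w, y, z)"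
    using A'[of "(x, w, y, z)"] by (auto simp: even_images_def)
  have desc: "descends A (adjoin K ?S) ?L"
  proof -
    have "descends A (adjoin K ?S) (adjoin K (insert (x + y) ?S))"
    proof (rule quadratic_step[OF f(1)])
      have fx: "f (x + y) = z + w"
        using f by (simp add: endo_simps)
      then show "x + y + f (x + y) \<in> adjoin K ?S" "(x + y) * f (x + y) \<in> adjoin K ?S"
        by (simp_all add: adjoin_genI add.assoc[symmetric] flip: T_def a_def)
      show "f (x + y) \<noteq> x + y"
        using T0 dbl[of "x + y"] unfolding fx T_def by (metis add.assoc)
      show "\<forall>u\<in>?S. f u = u"
        using f TE[OF f(1)] by (simp add: a_def b_def endo_simps ac_simps)
    qed
    moreover have "descends A (adjoin K (insert (x + y) ?S)) (adjoin K (insert (x + z) (insert (x + y) ?S)))"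
    proof (rule quadratic_step[OF e(1)])
      have ex: "e (x + z) = y + w"
        using e by (simp add: endo_simps)
      have "x + z + (y + w) = T"
        by (simp add: T_def)
      then show "x + z + e (x + z) \<in> adjoin K (insert (x + y) ?S)"
          "(x + z) * e (x + z) \<in> adjoin K (insert (x + y) ?S)"
        by (simp_all add: ex adjoin_genI flip: b_def)
      show "e (x + z) \<noteq> x + z"
        using T0 dbl[of "x + z"] \<open>x + z + (y + w) = T\<close> unfolding ex by metis
      show "\<forall>u\<in>insert (x + y) ?S. e u = u"
        using e TE[OF e(1)] by (simp add: a_def b_def endo_simps ac_simps)
    qed
    moreover have "adjoin K (insert (x + z) (insert (x + y) ?S)) = ?L"
    proof (rule adjoin_eqI)
      show "insert (x + z) (insert (x + y) ?S) \<subseteq> ?L"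
        using mem memS by (simp add: adjoin_closed)
      let ?M = "adjoin K (insert (x + z) (insert (x + y) ?S))"
      have M: "T \<in> ?M" "E \<in> ?M" "x + y \<in> ?M" "x + z \<in> ?M"
        by (simp_all add: adjoin_genI)
      define u v s where "u = x + y" and "v = x + z" and "s = T + u + v"
      have "u \<in> ?M" "v \<in> ?M"
        using M by (simp_all only: u_def v_def)
      then have uv: "u \<in> ?M" "v \<in> ?M" "s \<in> ?M"
        using M by (simp_all only: s_def adjoin_closed)
      have s: "s = x + w"
      proof -
        have "s = x + w + 2 * (x + y + z)"
          by (simp add: s_def T_def u_def v_def)
        then show ?thesis by (simp add: two)
      qed
      \<comment> \<open>In characteristic two \<open>u\<close>, \<open>v\<close>, \<open>s\<close>
        are the differences of \<open>y\<close>, \<open>z\<close>, \<open>w\<close> from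
        \<open>x\<close>, with sum \<open>T\<close>; expanding \<open>E\<close> in \<open>x\<close>
        and these differences cancels the terms in x^2.\<close>
      have "x * T + (u * v + v * s + s * u) = E + 2 * (2 * x * x + x * y + x * z + x * w)"
        unfolding s by (simp add: E_def T_def u_def v_def algebra_simps)
      then have "x * T + (u * v + v * s + s * u) = E"
        by (simp add: two)
      then have "x * T = E - (u * v + v * s + s * u)"
        by (simp add: eq_diff_eq)
      then have "x = (E - (u * v + v * s + s * u)) / T"
        using T0 by (simp add: eq_divide_eq)
      also have "\<dots> \<in> ?M"
        by (intro adjoin_closed M uv)
      finally have "x \<in> ?M" .
      then have "x + u \<in> ?M" "x + v \<in> ?M" "x + s \<in> ?M"
        using uv by (simp_all add: adjoin_closed)
      with \<open>x \<in> ?M\<close> show "{x, y, z, w} \<subseteq> ?M"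
        by (simp add: u_def v_def s dbl')
    qed
    ultimately show ?thesis
      using descends_trans[OF is_subfield_adjoin] by metis
  qed
  have "card ?S \<le> 4"
    by (simp add: card_insert_if)
  then have trans: "transcendence_free K ?S" "card ?S = 4"
    using descends_transcendence_free[OF _ free _ _ desc] by simp_all
  have distS: "T \<noteq> E" "T \<noteq> a" "T \<noteq> b" "E \<noteq> a" "E \<noteq> b" "a \<noteq> b"
    using trans(2) by (auto simp: card_insert_if split: if_splits)
  then have "{T, E, a, b} - {a} = {T, E, b}" "{T, E, a, b} - {b} = {T, E, a}"
    by auto
  then have a: "\<not> algebraic_over (adjoin K {T, E, b}) a" and b: "\<not> algebraic_over (adjoin K {T, E, a}) b"
    using trans(1) by (auto simp: transcendence_free_def)
  have a0: "a \<noteq> 0" "a \<noteq> - b"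
    by (rule transcendental_neq[OF a is_subfield_adjoin]; simp add: adjoin_closed adjoin_genI)+
  have b0: "b \<noteq> 0"
    by (rule transcendental_neq[OF b is_subfield_adjoin]; simp add: adjoin_closed)
  have D: "a\<^sup>2 + a * b + b\<^sup>2 \<noteq> 0"
    using transcendental_quadratic[OF a is_subfield_adjoin, of b "b\<^sup>2"]
    by (simp add: adjoin_closed adjoin_genI mult.commute)
  have c: "c = - a - b"
    using sum by (simp add: eq_neg_iff_add_eq_0 algebra_simps)
  have c0: "c \<noteq> 0"
    using a0(2) sum by (auto simp: eq_neg_iff_add_eq_0)
  interpret TE: base_endos A "adjoin K {T, E}"
    using TE by (intro base_endos_adjoin) auto
  have "has_rational_invariants A (adjoin K {T, E}) (adjoin (adjoin K {T, E}) {a, b, c}) 2"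
  proof (rule TE.cyclic_plane_invariants[OF abc g(1) _ h(1) _ sum D a0(1) b0 c0])
    show "(g a, g b, g c) = (b, c, a)" "(h a, h b, h c) = (c, a, b)"
      using g h by (simp_all add: a_def b_def c_def endo_simps ac_simps)
  qed
  moreover have "adjoin (adjoin K {T, E}) {a, b, c} = adjoin K ?S"
    unfolding adjoin_adjoin
    by (rule adjoin_eqI) (simp_all add: adjoin_closed adjoin_genI c)
  moreover have S_L: "adjoin K ?S \<subseteq> ?L"
    using memS by (intro adjoin_least is_subfield_adjoin adjoin_base) simp
  ultimately have "has_rational_invariants A (adjoin K {T, E}) ?L 2"
    using has_rational_invariants_descends[OF _ desc S_L] by simp
  then have "has_rational_invariants A K ?L (card {T, E} + 2)"
    by (rule has_rational_invariants_adjoin) (use TE memS in auto)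
  then show ?thesis
    using distS(1) by (simp add: eval_nat_numeral)
qed

end

section \<open>Permutation groups acting on rational functions\<close>

lemma ratfun_permute_id: "ratfun_permute (\<lambda>i. i) = (\<lambda>f. f :: 'k::field ratfun)"
proof
  fix f :: "'k ratfun"
  have "mpoly_permute (\<lambda>i. i) p = p" for p :: "(nat, 'k) mpoly"
    by (rule poly_mapping_eqI) (simp add: lookup_mpoly_permute bij_id[unfolded id_def] map_key_id)
  then show "ratfun_permute (\<lambda>i. i) f = f"
    by (cases f) (simp add: ratfun_permute_Fract bij_id[unfolded id_def])
qed

lemma ratfun_var_eq_iff: "ratfun_var a = (ratfun_var b :: 'k::field ratfun) \<longleftrightarrow> a = b"
  using inj_ratfun_var by (auto simp: inj_def)

section \<open>Permutation groups and the variables they move\<close>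

locale permutation_group =
  fixes n :: nat and G :: "(nat \<Rightarrow> nat) set"
  assumes G: "subgroup G (sym_group n)"
begin

lemma permutes: "s \<in> G \<Longrightarrow> s permutes {1..n}"
  using subgroup.subset[OF G] by (auto simp: sym_group_def)

lemma bij: "s \<in> G \<Longrightarrow> bij s"
  using permutes permutes_bij by blast

lemma moved: "s \<in> G \<Longrightarrow> s i \<noteq> i \<Longrightarrow> i \<in> {1..n}"
  using permutes permutes_not_in by fastforce

text \<open>The type argument names the coefficient field, which occurs in neither \<open>n\<close>
  nor \<open>G\<close>.\<close>

definition invariants_rational :: "'k::field itself \<Rightarrow> bool" where
  "invariants_rational _ \<longleftrightarrow> has_rational_invariants (ratfun_permute ` G)
     (range ratfun_const) (ratfun_field n :: 'k ratfun set) n"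

lemma base_endos: "base_endos (ratfun_permute ` G) (range ratfun_const :: 'k::field ratfun set)"
proof
  have "(\<lambda>i. i) \<in> G"
    using subgroup.one_closed[OF G] by (simp add: sym_group_def id_def)
  then have "ratfun_permute (\<lambda>i. i) \<in> (ratfun_permute ` G :: ('k ratfun \<Rightarrow> _) set)"
    by (rule imageI)
  then show "(\<lambda>f. f) \<in> (ratfun_permute ` G :: ('k ratfun \<Rightarrow> _) set)"
    by (simp only: ratfun_permute_id)
qed (auto simp: field_endo_ratfun_permute bij ratfun_permute_const)

text \<open>The variables outside \<open>W\<close> are invariants themselves. They are moved into
  the base and account for n - |W| of the generators.\<close>

lemma invariants_rational_support:
  assumes W: "W \<subseteq> {1..n}" and fixed: "\<forall>s\<in>G. \<forall>m. m \<notin> W \<longrightarrow> s m = m"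
    and inv: "has_rational_invariants (ratfun_permute ` G)
      (adjoin (range ratfun_const) (ratfun_var ` ({1..n} - W)))
      (adjoin (adjoin (range ratfun_const) (ratfun_var ` ({1..n} - W))) (ratfun_var ` W) :: 'k::field ratfun set)
      (card W)"
  shows "invariants_rational TYPE('k)"
proof -
  have "{1..n} - W \<union> W = {1..n}"
    using W by auto
  then have "adjoin (adjoin (range ratfun_const) (ratfun_var ` ({1..n} - W))) (ratfun_var ` W) =
      (ratfun_field n :: 'k ratfun set)"
    by (simp add: adjoin_adjoin ratfun_field_def flip: image_Un)
  moreover have "has_rational_invariants (ratfun_permute ` G) (range ratfun_const)
      (ratfun_field n :: 'k ratfun set) (card (ratfun_var ` ({1..n} - W) :: 'k ratfun set) + card W)"
  proof (rule has_rational_invariants_adjoin)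
    show "ratfun_var ` ({1..n} - W) \<subseteq> (ratfun_field n :: 'k ratfun set)"
      by (auto simp: ratfun_field_def intro: adjoin_genI)
  qed (use inv calculation fixed in \<open>auto simp: ratfun_permute_var bij\<close>)
  moreover have "card (ratfun_var ` ({1..n} - W) :: 'k ratfun set) + card W = n"
    using W card_mono[OF _ W]
    by (simp add: card_image inj_on_subset[OF inj_ratfun_var] card_Diff_subset finite_subset)
  ultimately show ?thesis
    by (simp add: invariants_rational_def)
qed

lemma base_endos_support:
  assumes "\<forall>s\<in>G. \<forall>m. m \<notin> W \<longrightarrow> s m = m"
  shows "base_endos (ratfun_permute ` G)
    (adjoin (range ratfun_const) (ratfun_var ` ({1..n} - W)) :: 'k::field ratfun set)"
proof (rule base_endos.base_endos_adjoin[OF base_endos])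
  fix h :: "'k ratfun \<Rightarrow> 'k ratfun" and x :: "'k ratfun"
  assume "h \<in> ratfun_permute ` G" "x \<in> ratfun_var ` ({1..n} - W)"
  then obtain s m where s: "s \<in> G" "h = ratfun_permute s" "m \<notin> W" "x = ratfun_var m"
    by blast
  then have "s m = m"
    using assms by blast
  then show "h x = x"
    using s by (simp add: ratfun_permute_var bij)
qed

text \<open>Covers the full symmetric group on \<open>W\<close> with all other points fixed. The
  trivial group is the case of empty \<open>W\<close>, and a single transposition that of two
  points.\<close>

lemma symmetric:
  assumes fixed: "\<forall>s\<in>G. \<forall>m. m \<notin> W \<longrightarrow> s m = m" and W: "\<And>i. i \<in> W \<Longrightarrow> \<exists>s\<in>G. s i \<noteq> i"
    and tr: "\<And>i j. i \<in> W \<Longrightarrow> j \<in> W \<Longrightarrow> \<exists>s\<in>G. s i = j \<and> (\<forall>m\<in>W - {i, j}. s m = m)"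
  shows "invariants_rational TYPE('k::field)"
proof (rule invariants_rational_support[OF _ fixed])
  show sub: "W \<subseteq> {1..n}"
    using W moved by blast
  interpret E: base_endos "ratfun_permute ` G"
      "adjoin (range ratfun_const) (ratfun_var ` ({1..n} - W)) :: 'k ratfun set"
    by (rule base_endos_support[OF fixed])
  have "has_rational_invariants (ratfun_permute ` G)
      (adjoin (range ratfun_const) (ratfun_var ` ({1..n} - W)))
      (adjoin (adjoin (range ratfun_const) (ratfun_var ` ({1..n} - W))) (ratfun_var ` W) :: 'k ratfun set)
      (card (ratfun_var ` W :: 'k ratfun set))"
  proof (rule E.symmetric_invariants)
    show "finite (ratfun_var ` W :: 'k ratfun set)"
      using sub by (intro finite_imageI) (rule finite_subset, auto)
    fix h :: "'k ratfun \<Rightarrow> 'k ratfun"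
    assume "h \<in> ratfun_permute ` G"
    then obtain s where s: "s \<in> G" "h = ratfun_permute s" by blast
    have "s permutes W"
      by (rule permutes_superset[OF permutes[OF s(1)]]) (use fixed s in auto)
    then have "s ` W = W"
      by (rule permutes_image)
    then show "h ` ratfun_var ` W = ratfun_var ` W"
      by (metis (no_types, lifting) bij image_cong image_image ratfun_permute_var s)
  next
    fix t u :: "'k ratfun"
    assume "t \<in> ratfun_var ` W" "u \<in> ratfun_var ` W"
    then obtain i j where ij: "i \<in> W" "j \<in> W" "t = ratfun_var i" "u = ratfun_var j"
      by blast
    then obtain s where "s \<in> G" "s i = j" "\<forall>m\<in>W - {i, j}. s m = m"
      using tr by blast
    then show "\<exists>h\<in>ratfun_permute ` G. h t = u \<and> (\<forall>x\<in>ratfun_var ` W - {t, u}. h x = x)"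
      using ij bij by (intro bexI[of _ "ratfun_permute s"]) (auto simp: ratfun_permute_var ratfun_var_eq_iff)
  qed
  then show "has_rational_invariants (ratfun_permute ` G)
      (adjoin (range ratfun_const) (ratfun_var ` ({1..n} - W)))
      (adjoin (adjoin (range ratfun_const) (ratfun_var ` ({1..n} - W))) (ratfun_var ` W) :: 'k ratfun set)
      (card W)"
    by (simp add: card_image inj_on_subset[OF inj_ratfun_var])
qed

text \<open>Describing \<open>G\<close> through the triples of images turns the hypothesis into an
  equality of finite sets of numbers for a concrete group.\<close>

lemma cyclic3:
  assumes ijk: "distinct [i, j, k]" and fixed: "\<forall>s\<in>G. \<forall>m. m \<notin> {i, j, k} \<longrightarrow> s m = m"
    and im: "(\<lambda>s. (s i, s j, s k)) ` G = {(i, j, k), (j, k, i), (k, i, j)}"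
  shows "invariants_rational TYPE('k::field)"
proof (rule invariants_rational_support[OF _ fixed])
  let ?x = "ratfun_var :: nat \<Rightarrow> 'k ratfun"
  have rot: "(s i, s j, s k) \<in> {(i, j, k), (j, k, i), (k, i, j)}" if "s \<in> G" for s
    using imageI[OF that, of "\<lambda>s. (s i, s j, s k)"] unfolding im .
  obtain g where g: "g \<in> G" "g i = j" "g j = k" "g k = i"
  proof -
    have "(j, k, i) \<in> (\<lambda>s. (s i, s j, s k)) ` G"
      unfolding im by simp
    then show thesis using that by auto
  qed
  obtain h where h: "h \<in> G" "h i = k"
  proof -
    have "(k, i, j) \<in> (\<lambda>s. (s i, s j, s k)) ` G"
      unfolding im by simp
    then show thesis using that by auto
  qed
  show sub: "{i, j, k} \<subseteq> {1..n}"
    using moved[OF g(1)] g ijk by auto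
  let ?K = "adjoin (range ratfun_const) (?x ` ({1..n} - {i, j, k}))"
  interpret E: base_endos "ratfun_permute ` G" ?K
    by (rule base_endos_support[OF fixed])
  have "has_rational_invariants (ratfun_permute ` G) ?K (adjoin ?K {?x i, ?x j, ?x k}) 3"
  proof (rule E.cyclic3_invariants[of _ _ _ "ratfun_permute g" "ratfun_permute h"])
    show "(f (?x i), f (?x j), f (?x k)) \<in>
        {(?x i, ?x j, ?x k), (?x j, ?x k, ?x i), (?x k, ?x i, ?x j)}" if f: "f \<in> ratfun_permute ` G" for f
    proof -
      obtain s where s: "s \<in> G" "f = ratfun_permute s"
        using f by blast
      then show ?thesis
        using rot[OF s(1)] by (auto simp: ratfun_permute_var bij)
    qed
    have "\<not> algebraic_over (adjoin (range ratfun_const) (?x ` {1..n} - {?x i})) (?x i)"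
      using transcendence_free_ratfun_var[of "{1..n}"] sub by (auto simp: transcendence_free_def)
    moreover have "?x ` {1..n} - {?x i} = ?x ` ({1..n} - {i, j, k}) \<union> {?x j, ?x k}"
      using sub ijk by (auto simp: ratfun_var_eq_iff)
    ultimately show "\<not> algebraic_over (adjoin ?K {?x j, ?x k}) (?x i)"
      by (simp only: adjoin_adjoin not_False_eq_True)
  qed (use g h ijk in \<open>simp_all add: ratfun_permute_var bij ratfun_var_eq_iff\<close>)
  then show "has_rational_invariants (ratfun_permute ` G) ?K (adjoin ?K (?x ` {i, j, k})) (card {i, j, k})"
    using ijk by (simp add: eval_nat_numeral)
qed

end

section \<open>Groups that move four points\<close>

locale four_permutation_group = permutation_group +
  fixes i j k l :: nat
  assumes n_le: "n \<le> 4" and ijkl: "distinct [i, j, k, l]" "\<And>m. m \<in> {i, j, k, l} \<Longrightarrow> \<exists>s\<in>G. s m \<noteq> m"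
begin

text \<open>Moved points lie in {1..n}, and four of them exhaust it. Their order is left open, so
  that one lemma serves all conjugates of a subgroup.\<close>

lemma n: "n = 4" and interval: "{1..n} = {i, j, k, l}"
proof -
  have sub: "{i, j, k, l} \<subseteq> {1..n}"
    using ijkl(2) moved by blast
  have card: "card {i, j, k, l} = 4"
    using ijkl(1) by simp
  then show "n = 4"
    using card_mono[OF _ sub] n_le by simp
  then show "{1..n} = {i, j, k, l}"
    using card_subset_eq[OF _ sub] card by simp
qed

lemma invariants_rationalI:
  "has_rational_invariants (ratfun_permute ` G) (range ratfun_const)
    (adjoin (range ratfun_const) {ratfun_var i, ratfun_var j, ratfun_var k, ratfun_var l :: 'k::field ratfun}) 4
   \<Longrightarrow> invariants_rational TYPE('k)"
  unfolding invariants_rational_def ratfun_field_def interval unfolding n by simp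

lemma free: "transcendence_free (range ratfun_const)
    {ratfun_var i, ratfun_var j, ratfun_var k, ratfun_var l :: 'k::field ratfun}"
  using transcendence_free_ratfun_var[of "{i, j, k, l}"] by simp

lemma transcendental: "\<not> algebraic_over (adjoin (range ratfun_const)
    {ratfun_var j, ratfun_var k, ratfun_var l}) (ratfun_var i :: 'k::field ratfun)"
proof -
  have "{ratfun_var i, ratfun_var j, ratfun_var k, ratfun_var l} - {ratfun_var i} =
      {ratfun_var j, ratfun_var k, ratfun_var l :: 'k ratfun}"
    using ijkl(1) by (auto simp: ratfun_var_eq_iff)
  then show ?thesis
    using free unfolding transcendence_free_def by (metis insertI1)
qed

abbreviation images :: "(nat \<times> nat \<times> nat \<times> nat) set" where
  "images \<equiv> (\<lambda>s. (s i, s j, s k, s l)) ` G"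

abbreviation var_tuple :: "nat \<times> nat \<times> nat \<times> nat \<Rightarrow>
    'k::field ratfun \<times> 'k ratfun \<times> 'k ratfun \<times> 'k ratfun" where
  "var_tuple \<equiv> map_prod ratfun_var (map_prod ratfun_var (map_prod ratfun_var ratfun_var))"

lemma image_var:
  assumes "f \<in> ratfun_permute ` G"
  shows "(f (ratfun_var i), f (ratfun_var j), f (ratfun_var k), f (ratfun_var l :: 'k::field ratfun))
    \<in> var_tuple ` images"
proof -
  obtain s where s: "s \<in> G" "f = ratfun_permute s"
    using assms by blast
  then show ?thesis
    unfolding image_image by (intro image_eqI[of _ _ s]) (simp_all add: ratfun_permute_var bij)
qed

lemma obtain_image:
  assumes "(a, b, c, d) \<in> images"
  obtains f where "f \<in> ratfun_permute ` G" "f (ratfun_var i) = ratfun_var a" "f (ratfun_var j) = ratfun_var b"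
    "f (ratfun_var k) = ratfun_var c" "f (ratfun_var l) = (ratfun_var d :: 'k::field ratfun)"
proof -
  obtain s where "(a, b, c, d) = (s i, s j, s k, s l)" "s \<in> G"
    using assms by (rule imageE)
  then show thesis
    by (intro that[of "ratfun_permute s"]) (simp_all add: ratfun_permute_var bij)
qed

sublocale E: base_endos "ratfun_permute ` G" "range ratfun_const :: 'k::field ratfun set"
  by (rule base_endos)

lemma double_transposition:
  assumes im: "images = {(i, j, k, l), (j, i, l, k)}"
  shows "invariants_rational TYPE('k::field)"
proof -
  obtain g where g: "g \<in> ratfun_permute ` G" "g (ratfun_var i) = (ratfun_var j :: 'k ratfun)"
    by (rule obtain_image[of j i l k]) (simp_all add: im)
  show ?thesis
    by (rule invariants_rationalI, rule E.double_transposition_invariants[OF _ g])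
      (use image_var[unfolded im] ijkl(1) in \<open>auto simp: ratfun_var_eq_iff\<close>)
qed

lemma two_transpositions:
  assumes im: "images = {(i, j, k, l), (j, i, k, l), (i, j, l, k), (j, i, l, k)}"
  shows "invariants_rational TYPE('k::field)"
proof -
  obtain g where g: "g \<in> ratfun_permute ` G" "g (ratfun_var i) = (ratfun_var j :: 'k ratfun)"
      "g (ratfun_var k) = (ratfun_var k :: 'k ratfun)"
    by (rule obtain_image[of j i k l]) (simp_all add: im)
  obtain h where h: "h \<in> ratfun_permute ` G" "h (ratfun_var i) = (ratfun_var i :: 'k ratfun)"
      "h (ratfun_var k) = (ratfun_var l :: 'k ratfun)"
    by (rule obtain_image[of i j l k]) (simp_all add: im)
  show ?thesis
    by (rule invariants_rationalI, rule E.two_transpositions_invariants[OF _ g h])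
      (use image_var[unfolded im] ijkl(1) in \<open>auto simp: ratfun_var_eq_iff\<close>)
qed

lemma dihedral:
  assumes im: "images = {(i, j, k, l), (j, i, k, l), (i, j, l, k), (j, i, l, k),
      (k, l, i, j), (l, k, i, j), (k, l, j, i), (l, k, j, i)}"
  shows "invariants_rational TYPE('k::field)"
proof -
  obtain f where f: "f \<in> ratfun_permute ` G" "f (ratfun_var i) = (ratfun_var k :: 'k ratfun)"
    by (rule obtain_image[of k l i j]) (simp_all add: im)
  obtain g where g: "g \<in> ratfun_permute ` G" "g (ratfun_var i) = (ratfun_var j :: 'k ratfun)"
      "g (ratfun_var k) = (ratfun_var k :: 'k ratfun)"
    by (rule obtain_image[of j i k l]) (simp_all add: im)
  obtain h where h: "h \<in> ratfun_permute ` G" "h (ratfun_var i) = (ratfun_var i :: 'k ratfun)"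
      "h (ratfun_var k) = (ratfun_var l :: 'k ratfun)"
    by (rule obtain_image[of i j l k]) (simp_all add: im)
  have "ratfun_var i \<noteq> ratfun_var k + ratfun_var l - (ratfun_var j :: 'k ratfun)"
    by (rule transcendental_neq[OF transcendental is_subfield_adjoin]) (simp add: adjoin_closed adjoin_genI)
  then have ne: "ratfun_var i + ratfun_var j \<noteq> ratfun_var k + (ratfun_var l :: 'k ratfun)"
    by (simp add: eq_diff_eq)
  have ne': "ratfun_var i \<noteq> (ratfun_var j :: 'k ratfun)" "ratfun_var k \<noteq> (ratfun_var l :: 'k ratfun)"
      "ratfun_var i \<noteq> (ratfun_var k :: 'k ratfun)" "ratfun_var j \<noteq> (ratfun_var k :: 'k ratfun)"
    using ijkl(1) by (simp_all add: ratfun_var_eq_iff)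
  show ?thesis
    by (rule invariants_rationalI, rule E.dihedral_invariants[OF _ f g h ne' ne])
      (drule image_var, simp add: im)
qed

lemma klein:
  assumes im: "images = {(i, j, k, l), (j, i, l, k), (k, l, i, j), (l, k, j, i)}"
  shows "invariants_rational TYPE('k::field)"
proof -
  obtain g where g: "g \<in> ratfun_permute ` G" "g (ratfun_var i) = (ratfun_var j :: 'k ratfun)"
    by (rule obtain_image[of j i l k]) (simp_all add: im)
  obtain h where h: "h \<in> ratfun_permute ` G" "h (ratfun_var i) = (ratfun_var k :: 'k ratfun)"
    by (rule obtain_image[of k l i j]) (simp_all add: im)
  show ?thesis
    by (rule invariants_rationalI, rule E.klein_invariants[OF _ g h transcendental])
      (use image_var[unfolded im] ijkl(1) in \<open>auto simp: ratfun_var_eq_iff\<close>)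
qed

lemma cyclic4:
  assumes im: "images = {(i, j, k, l), (j, k, l, i), (k, l, i, j), (l, i, j, k)}"
  shows "invariants_rational TYPE('k::field)"
proof -
  obtain g where g: "g \<in> ratfun_permute ` G" "g (ratfun_var i) = (ratfun_var j :: 'k ratfun)"
    by (rule obtain_image[of j k l i]) (simp_all add: im)
  obtain h where h: "h \<in> ratfun_permute ` G" "h (ratfun_var i) = (ratfun_var k :: 'k ratfun)"
    by (rule obtain_image[of k l i j]) (simp_all add: im)
  have rot: "(f (ratfun_var i), f (ratfun_var j), f (ratfun_var k), f (ratfun_var l :: 'k ratfun)) \<in>
      {(ratfun_var i, ratfun_var j, ratfun_var k, ratfun_var l),
       (ratfun_var j, ratfun_var k, ratfun_var l, ratfun_var i),
       (ratfun_var k, ratfun_var l, ratfun_var i, ratfun_var j),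
       (ratfun_var l, ratfun_var i, ratfun_var j, ratfun_var k)}" if "f \<in> ratfun_permute ` G" for f
    using image_var[OF that] unfolding im by simp
  have ne: "ratfun_var j \<noteq> (ratfun_var k :: 'k ratfun)" "ratfun_var j \<noteq> (ratfun_var l :: 'k ratfun)"
      "ratfun_var k \<noteq> (ratfun_var l :: 'k ratfun)"
    using ijkl(1) by (simp_all add: ratfun_var_eq_iff)
  show ?thesis
    by (rule invariants_rationalI, cases "(2 :: 'k ratfun) = 0")
      (rule E.cyclic4_invariants_even[OF rot g h transcendental ne]
        E.cyclic4_invariants_odd[OF rot g h transcendental ne]; assumption)+
qed

lemma alternating:
  assumes im: "images = even_images i j k l"
  shows "invariants_rational TYPE('k::field)"
proof -
  let ?x = "ratfun_var :: nat \<Rightarrow> 'k ratfun"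
  have even: "var_tuple ` images = even_images (?x i) (?x j) (?x k) (?x l)"
    unfolding im even_images_def by simp
  have in_even: "(f (?x i), f (?x j), f (?x k), f (?x l)) \<in> even_images (?x i) (?x j) (?x k) (?x l)"
    if "f \<in> ratfun_permute ` G" for f
    using image_var[OF that] unfolding even .
  have ex: "\<exists>f\<in>ratfun_permute ` G. (f (?x i), f (?x j), f (?x k), f (?x l)) = t"
    if t: "t \<in> even_images (?x i) (?x j) (?x k) (?x l)" for t
  proof -
    obtain s where "t = var_tuple (s i, s j, s k, s l)" "s \<in> G"
      using t unfolding even[symmetric] image_image by (rule imageE)
    then show ?thesis
      by (intro bexI[of _ "ratfun_permute s"]) (auto simp: ratfun_permute_var bij)
  qed
  have card: "card {?x i, ?x j, ?x k, ?x l} = 4"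
    using ijkl(1) by (simp add: ratfun_var_eq_iff)
  show ?thesis
    by (rule invariants_rationalI, cases "(2 :: 'k ratfun) = 0")
      (rule E.alternating4_invariants_even[OF in_even ex free card]
        E.alternating4_invariants_odd[OF in_even ex free card]; assumption)+
qed

end

section \<open>The subgroups of the symmetric group of degree four\<close>

text \<open>One-line notation: composites and equalities of concrete permutations reduce to
  evaluation and comparison of numerals.\<close>

definition perm4 :: "nat \<Rightarrow> nat \<Rightarrow> nat \<Rightarrow> nat \<Rightarrow> nat \<Rightarrow> nat" where
  "perm4 a b c d = id(1 := a, 2 := b, 3 := c, 4 := d)"

lemma perm4_apply: "perm4 a b c d 1 = a" "perm4 a b c d 2 = b" "perm4 a b c d 3 = c" "perm4 a b c d 4 = d"
  by (simp_all add: perm4_def)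

lemma perm4_other: "m \<notin> {1, 2, 3, 4} \<Longrightarrow> perm4 a b c d m = m"
  by (simp add: perm4_def)

lemma perm4_comp: "perm4 a b c d \<circ> perm4 e f g h =
    perm4 (perm4 a b c d e) (perm4 a b c d f) (perm4 a b c d g) (perm4 a b c d h)"
proof
  fix m
  show "(perm4 a b c d \<circ> perm4 e f g h) m =
      perm4 (perm4 a b c d e) (perm4 a b c d f) (perm4 a b c d g) (perm4 a b c d h) m"
  proof (cases "m \<in> {1, 2, 3, 4}")
    case True
    then show ?thesis by (elim insertE emptyE) (simp_all only: perm4_apply o_apply)
  next
    case False
    then show ?thesis by (simp only: perm4_other[OF False] o_apply)
  qed
qed

lemma perm4_eq_iff: "perm4 a b c d = perm4 a' b' c' d' \<longleftrightarrow> a = a' \<and> b = b' \<and> c = c' \<and> d = d'"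
  by (metis perm4_apply)

definition perms4 :: "(nat \<Rightarrow> nat) set" where
  "perms4 =
    {perm4 1 2 3 4, perm4 1 2 4 3, perm4 1 3 2 4, perm4 1 3 4 2, perm4 1 4 2 3, perm4 1 4 3 2, perm4
     2 1 3 4, perm4 2 1 4 3, perm4 2 3 1 4, perm4 2 3 4 1, perm4 2 4 1 3, perm4 2 4 3 1, perm4 3 1 2
     4, perm4 3 1 4 2, perm4 3 2 1 4, perm4 3 2 4 1, perm4 3 4 1 2, perm4 3 4 2 1, perm4 4 1 2 3,
     perm4 4 1 3 2, perm4 4 2 1 3, perm4 4 2 3 1, perm4 4 3 1 2, perm4 4 3 2 1}"

lemma permutes_imp_perms4:
  assumes "s permutes {1..4}"
  shows "s \<in> perms4"
proof -
  have "s m = perm4 (s 1) (s 2) (s 3) (s 4) m" for m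
  proof (cases "m \<in> {1, 2, 3, 4}")
    case True
    then show ?thesis by (elim insertE emptyE) (simp_all only: perm4_apply)
  next
    case False
    then have "m \<notin> {1..4}" by auto
    then show ?thesis
      using permutes_not_in[OF assms] by (simp only: perm4_other[OF False])
  qed
  then have eq: "s = perm4 (s 1) (s 2) (s 3) (s 4)"
    by blast
  have "s m \<in> {1, 2, 3, 4}" if "m \<in> {1, 2, 3, 4}" for m
    using permutes_in_image[OF assms, of m] that by auto
  then have "s 1 \<in> {1, 2, 3, 4}" "s 2 \<in> {1, 2, 3, 4}" "s 3 \<in> {1, 2, 3, 4}" "s 4 \<in> {1, 2, 3, 4}"
    by blast+
  moreover have "distinct [s 1, s 2, s 3, s 4]"
    using permutes_inj[OF assms] by (simp add: inj_eq)
  ultimately have "perm4 (s 1) (s 2) (s 3) (s 4) \<in> perms4"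
    by (elim insertE emptyE) (simp_all add: perms4_def)
  then show ?thesis
    using eq by simp
qed

text \<open>With the membership of each of the 24 permutations as a propositional atom, closure under
  composition becomes a set of clauses whose models are the 30 subgroups.\<close>

lemma subgroups_perms4:
  assumes "G \<subseteq> perms4" "id \<in> G" and comp: "\<forall>s\<in>G. \<forall>t\<in>G. s \<circ> t \<in> G"
  shows "G \<in>
    {{perm4 1 2 3 4},
     {perm4 1 2 3 4, perm4 2 1 3 4},
     {perm4 1 2 3 4, perm4 3 2 1 4},
     {perm4 1 2 3 4, perm4 4 2 3 1},
     {perm4 1 2 3 4, perm4 1 3 2 4},
     {perm4 1 2 3 4, perm4 1 4 3 2},
     {perm4 1 2 3 4, perm4 1 2 4 3},
     {perm4 1 2 3 4, perm4 1 3 2 4, perm4 2 1 3 4, perm4 2 3 1 4, perm4 3 1 2 4, perm4 3 2 1 4},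
     {perm4 1 2 3 4, perm4 1 4 3 2, perm4 2 1 3 4, perm4 2 4 3 1, perm4 4 1 3 2, perm4 4 2 3 1},
     {perm4 1 2 3 4, perm4 1 2 4 3, perm4 3 2 1 4, perm4 3 2 4 1, perm4 4 2 1 3, perm4 4 2 3 1},
     {perm4 1 2 3 4, perm4 1 2 4 3, perm4 1 3 2 4, perm4 1 3 4 2, perm4 1 4 2 3, perm4 1 4 3 2},
     {perm4 1 2 3 4, perm4 1 2 4 3, perm4 1 3 2 4, perm4 1 3 4 2, perm4 1 4 2 3, perm4 1 4 3 2,
      perm4 2 1 3 4, perm4 2 1 4 3, perm4 2 3 1 4, perm4 2 3 4 1, perm4 2 4 1 3, perm4 2 4 3 1,
      perm4 3 1 2 4, perm4 3 1 4 2, perm4 3 2 1 4, perm4 3 2 4 1, perm4 3 4 1 2, perm4 3 4 2 1,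
      perm4 4 1 2 3, perm4 4 1 3 2, perm4 4 2 1 3, perm4 4 2 3 1, perm4 4 3 1 2, perm4 4 3 2 1},
     {perm4 1 2 3 4, perm4 2 3 1 4, perm4 3 1 2 4},
     {perm4 1 2 3 4, perm4 2 4 3 1, perm4 4 1 3 2},
     {perm4 1 2 3 4, perm4 3 2 4 1, perm4 4 2 1 3},
     {perm4 1 2 3 4, perm4 1 3 4 2, perm4 1 4 2 3},
     {perm4 1 2 3 4, perm4 2 1 4 3},
     {perm4 1 2 3 4, perm4 3 4 1 2},
     {perm4 1 2 3 4, perm4 4 3 2 1},
     {perm4 1 2 3 4, perm4 1 2 4 3, perm4 2 1 3 4, perm4 2 1 4 3},
     {perm4 1 2 3 4, perm4 1 4 3 2, perm4 3 2 1 4, perm4 3 4 1 2},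
     {perm4 1 2 3 4, perm4 1 3 2 4, perm4 4 2 3 1, perm4 4 3 2 1},
     {perm4 1 2 3 4, perm4 2 3 4 1, perm4 3 4 1 2, perm4 4 1 2 3},
     {perm4 1 2 3 4, perm4 2 4 1 3, perm4 3 1 4 2, perm4 4 3 2 1},
     {perm4 1 2 3 4, perm4 2 1 4 3, perm4 3 4 2 1, perm4 4 3 1 2},
     {perm4 1 2 3 4, perm4 2 1 4 3, perm4 3 4 1 2, perm4 4 3 2 1},
     {perm4 1 2 3 4, perm4 1 2 4 3, perm4 2 1 3 4, perm4 2 1 4 3, perm4 3 4 1 2, perm4 3 4 2 1,
      perm4 4 3 1 2, perm4 4 3 2 1},
     {perm4 1 2 3 4, perm4 1 4 3 2, perm4 2 1 4 3, perm4 2 3 4 1, perm4 3 2 1 4, perm4 3 4 1 2,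
      perm4 4 1 2 3, perm4 4 3 2 1},
     {perm4 1 2 3 4, perm4 1 3 2 4, perm4 2 1 4 3, perm4 2 4 1 3, perm4 3 1 4 2, perm4 3 4 1 2,
      perm4 4 2 3 1, perm4 4 3 2 1},
     {perm4 1 2 3 4, perm4 1 3 4 2, perm4 1 4 2 3, perm4 2 1 4 3, perm4 2 3 1 4, perm4 2 4 3 1,
      perm4 3 1 2 4, perm4 3 2 4 1, perm4 3 4 1 2, perm4 4 1 3 2, perm4 4 2 1 3, perm4 4 3 2 1}}"
proof -
  have "perm4 1 2 3 4 = id"
    by (auto simp: perm4_def fun_eq_iff)
  then have id: "perm4 1 2 3 4 \<in> G"
    using assms(2) by simp
  \<comment> \<open>For a finite set of permutations, closure under composition already gives
    closure under inverses, so clauses about products determine the subgroups.\<close>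
  have closed: "\<forall>s\<in>perms4. \<forall>t\<in>perms4. s \<in> G \<and> t \<in> G \<longrightarrow> s \<circ> t \<in> G"
    using comp by blast
  \<comment> \<open>Equality with a listed set becomes one condition per permutation; the
    memberships in \<open>S\<close> are decided by comparing numerals, which leaves only the atoms
    about \<open>G\<close>.\<close>
  have eq: "G = S \<longleftrightarrow> (\<forall>s\<in>perms4. s \<in> G \<longleftrightarrow> s \<in> S) \<and> (\<forall>s\<in>S. s \<in> perms4)" for S
    using assms(1) by blast
  have ball: "(\<forall>s\<in>insert p S. Q s) \<longleftrightarrow> Q p \<and> (\<forall>s\<in>S. Q s)" for p :: "nat \<Rightarrow> nat" and S Q
    by simp
  show ?thesis
    by (simp only: eq insert_iff empty_iff perms4_def ball ball_empty perm4_eq_iff one_eq_numeral_iff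
        numeral_eq_one_iff numeral_eq_iff num.distinct num.inject simp_thms,
      insert id closed[unfolded perms4_def ball ball_empty perm4_comp perm4_apply], sat)
qed

text \<open>All \<open>n\<close> are treated at once: a permutation of {1..n} is also one of {1..4},
  and each case speaks only of the points that \<open>G\<close> moves, which lie in {1..n}.\<close>

lemma (in permutation_group) invariants_rational_le_4:
  assumes n: "n \<le> 4"
  shows "invariants_rational TYPE('k::field)"
proof -
  have four: "four_permutation_group n G i j k l"
    if "distinct [i, j, k, l]" "\<forall>m\<in>{i, j, k, l}. \<exists>s\<in>G. s m \<noteq> m" for i j k l
    by unfold_locales (use n that in blast)+
  have perm: "s permutes {1..4}" if "s \<in> G" for s
    using permutes_subset[OF permutes[OF that]] n by simp
  \<comment> \<open>Reduces a condition on all natural numbers to four numerals, within reach of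
    simplification.\<close>
  have fixed: "\<forall>s\<in>G. \<forall>m. m \<notin> W \<longrightarrow> s m = m"
    if "\<forall>s\<in>G. \<forall>m\<in>{1, 2, 3, 4}. m \<notin> W \<longrightarrow> s m = m" for W
  proof (intro ballI allI impI)
    fix s m
    assume s: "s \<in> G" and m: "m \<notin> W"
    show "s m = m"
    proof (cases "m \<in> {1, 2, 3, 4}")
      case True
      then show ?thesis using that s m by blast
    next
      case False
      then have "m \<notin> {1..4}" by auto
      then show ?thesis by (rule permutes_not_in[OF perm[OF s]])
    qed
  qed
  have sym: "invariants_rational TYPE('k)"
    if "\<forall>s\<in>G. \<forall>m\<in>{1, 2, 3, 4}. m \<notin> W \<longrightarrow> s m = m"
      and moves: "\<forall>i\<in>W. \<exists>s\<in>G. s i \<noteq> i"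
      and swaps: "\<forall>i\<in>W. \<forall>j\<in>W. \<exists>s\<in>G. s i = j \<and> (\<forall>m\<in>W. m \<noteq> i \<longrightarrow> m \<noteq> j \<longrightarrow> s m = m)" for W
  proof (rule symmetric[OF fixed[OF that(1)]])
    show "\<exists>s\<in>G. s i \<noteq> i" if "i \<in> W" for i
      using moves that by (rule bspec)
    show "\<exists>s\<in>G. s i = j \<and> (\<forall>m\<in>W - {i, j}. s m = m)" if "i \<in> W" "j \<in> W" for i j
      using bspec[OF bspec[OF swaps that(1)] that(2)] by (elim bexE conjE, intro bexI conjI) simp_all
  qed
  have cyc3: "invariants_rational TYPE('k)"
    if "distinct [i, j, k]" "\<forall>s\<in>G. \<forall>m\<in>{1, 2, 3, 4}. m \<notin> {i, j, k} \<longrightarrow> s m = m"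
      "(\<lambda>s. (s i, s j, s k)) ` G = {(i, j, k), (j, k, i), (k, i, j)}" for i j k
    by (rule cyclic3[OF that(1) fixed[OF that(2)] that(3)])
  have sub: "G \<subseteq> perms4"
    using permutes_imp_perms4[OF perm] by blast
  have closed: "id \<in> G" "\<forall>s\<in>G. \<forall>t\<in>G. s \<circ> t \<in> G"
    using subgroup.one_closed[OF G] subgroup.m_closed[OF G] by (simp_all add: sym_group_def)
  from subgroups_perms4[OF sub closed] show ?thesis
  \<comment> \<open>The goals come in the order of the list: 12 full symmetric groups on subsets of
    the points, 4 groups of order three, 3 double transpositions, 3 pairs of disjoint
    transpositions, 3 cyclic groups of order four, the normal Klein group, 3 dihedral groups and the
    alternating group. The instantiations select the blocks or the cyclic order of each
    conjugate.\<close>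
  apply (elim insertE emptyE)
  subgoal by (rule sym[of "{}"]; simp add: perm4_apply del: One_nat_def)
  subgoal by (rule sym[of "{1, 2}"]; simp add: perm4_apply del: One_nat_def)
  subgoal by (rule sym[of "{1, 3}"]; simp add: perm4_apply del: One_nat_def)
  subgoal by (rule sym[of "{1, 4}"]; simp add: perm4_apply del: One_nat_def)
  subgoal by (rule sym[of "{2, 3}"]; simp add: perm4_apply del: One_nat_def)
  subgoal by (rule sym[of "{2, 4}"]; simp add: perm4_apply del: One_nat_def)
  subgoal by (rule sym[of "{3, 4}"]; simp add: perm4_apply del: One_nat_def)
  subgoal by (rule sym[of "{1, 2, 3}"]; simp add: perm4_apply del: One_nat_def)
  subgoal by (rule sym[of "{1, 2, 4}"]; simp add: perm4_apply del: One_nat_def)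
  subgoal by (rule sym[of "{1, 3, 4}"]; simp add: perm4_apply del: One_nat_def)
  subgoal by (rule sym[of "{2, 3, 4}"]; simp add: perm4_apply del: One_nat_def)
  subgoal by (rule sym[of "{1, 2, 3, 4}"]; simp add: perm4_apply del: One_nat_def)
  subgoal by (rule cyc3[of 1 2 3]; simp add: perm4_apply del: One_nat_def)
  subgoal by (rule cyc3[of 1 2 4]; simp add: perm4_apply del: One_nat_def)
  subgoal by (rule cyc3[of 1 3 4]; simp add: perm4_apply del: One_nat_def)
  subgoal by (rule cyc3[of 2 3 4]; simp add: perm4_apply del: One_nat_def)
  subgoal by (rule four_permutation_group.double_transposition[OF four, of 1 2 3 4]; simp add: perm4_apply insert_commute del: One_nat_def)
  subgoal by (rule four_permutation_group.double_transposition[OF four, of 1 3 2 4]; simp add: perm4_apply insert_commute del: One_nat_def)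
  subgoal by (rule four_permutation_group.double_transposition[OF four, of 1 4 2 3]; simp add: perm4_apply insert_commute del: One_nat_def)
  subgoal by (rule four_permutation_group.two_transpositions[OF four, of 1 2 3 4]; simp add: perm4_apply insert_commute del: One_nat_def)
  subgoal by (rule four_permutation_group.two_transpositions[OF four, of 1 3 2 4]; simp add: perm4_apply insert_commute del: One_nat_def)
  subgoal by (rule four_permutation_group.two_transpositions[OF four, of 1 4 2 3]; simp add: perm4_apply insert_commute del: One_nat_def)
  subgoal by (rule four_permutation_group.cyclic4[OF four, of 1 2 3 4]; simp add: perm4_apply insert_commute del: One_nat_def)
  subgoal by (rule four_permutation_group.cyclic4[OF four, of 1 2 4 3]; simp add: perm4_apply insert_commute del: One_nat_def)
  subgoal by (rule four_permutation_group.cyclic4[OF four, of 1 3 2 4]; simp add: perm4_apply insert_commute del: One_nat_def)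
  subgoal by (rule four_permutation_group.klein[OF four, of 1 2 3 4]; simp add: perm4_apply insert_commute del: One_nat_def)
  subgoal by (rule four_permutation_group.dihedral[OF four, of 1 2 3 4]; simp add: perm4_apply insert_commute del: One_nat_def)
  subgoal by (rule four_permutation_group.dihedral[OF four, of 1 3 2 4]; simp add: perm4_apply insert_commute del: One_nat_def)
  subgoal by (rule four_permutation_group.dihedral[OF four, of 1 4 2 3]; simp add: perm4_apply insert_commute del: One_nat_def)
  subgoal by (rule four_permutation_group.alternating[OF four, of 1 2 3 4]; simp add: perm4_apply even_images_def insert_commute del: One_nat_def)
  done
qed

theorem theorem3p3:
  fixes n :: nat and G :: "(nat \<Rightarrow> nat) set"
  assumes "subgroup G (sym_group n)" and "n \<le> 4"
  shows "rational_over (range ratfun_const) (ratfun_fixed_field n G :: 'k::field ratfun set)"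
proof -
  interpret permutation_group n G
    by (rule permutation_group.intro) fact
  show ?thesis
    using invariants_rational_le_4[OF assms(2)] bij
    unfolding invariants_rational_def by (intro rational_over_fixed_field)
qed

end
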